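(* Let $V$ be a finite-dimensional irreducible $U_q(\mathfrak{g})$-module of type $\varepsilon=(\varepsilon_i)_{i=1}^n$. Let $\alpha=(\alpha_i)_{i=1}^n \in (\mathbb{F}^\times)^n$. Then there exists a unique $U^{\ge 0}$-module structure on $V$ such that the operators $E_i - \varepsilon_i \alpha_i^{-1} e_i$ and $K_i^{\pm 1} - \varepsilon_i \alpha_i^{\mp 1}k_i^{\pm 1}$ vanish on $V$ for $1 \le i \le n$. This $U^{\ge 0}$-module structure is irreducible and of type $\alpha$.
   Context: $\mathbb{F}$ is an algebraically closed field of characteristic $0$, $\mathbb{F}^\times=\mathbb{F}\setminus\{0\}$, and $q\in\mathbb{F}^\times$ is not a root of unity. $A=(A_{ij})$ is a symmetrizable generalized Cartan matrix of order $n$ and affine type (in the sense of Kac: indecomposable, of corank 1, with $Au=0$ for some column vector $u$ with positive entries). $s_1,\dots,s_n$ are relatively prime positive integers with $s_iA_{ij}=s_jA_{ji}$ for all $i,j$; put $q_i=q^{s_i}$, $[m]_i=\frac{q_i^m-q_i^{-m}}{q_i-q_i^{-1}}$, $[m]_i^!=[m]_i[m-1]_i\cdots[1]_i$ with $[0]_i^!=1$, and $\begin{bmatrix} m\\ r\end{bmatrix}_i=\frac{[m]_i^!}{[r]_i^![m-r]_i^!}$ for integers $m\ge r\ge 0$. $\mathfrak{g}=\mathfrak{g}'(A)$ is the Kac-Moody algebra over $\mathbb{C}$ of $A$. $U_q(\mathfrak{g})$ is the unital associative $\mathbb{F}$-algebra with generators $E_i,F_i,K_i^{\pm1}$ ($1\le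 i\le n$) and relations: $K_iK_i^{-1}=K_i^{-1}K_i=1$; $K_iK_j=K_jK_i$; $K_iE_jK_i^{-1}=q_i^{A_{ij}}E_j$; $K_iF_jK_i^{-1}=q_i^{-A_{ij}}F_j$; $E_iF_j-F_jE_i=\delta_{ij}\frac{K_i-K_i^{-1}}{q_i-q_i^{-1}}$; and, for $i\ne j$, $\sum_{r=0}^{1-A_{ij}}(-1)^r\begin{bmatrix}1-A_{ij}\\ r\end{bmatrix}_iE_i^{1-A_{ij}-r}E_jE_i^r=0$ and the same relation with every $E$ replaced by $F$. $U^{\ge0}$ is the unital associative $\mathbb{F}$-algebra with generators $e_i,k_i^{\pm1}$ ($1\le i\le n$) and relations: $k_ik_i^{-1}=k_i^{-1}k_i=1$; $k_ik_j=k_jk_i$; $k_ie_jk_i^{-1}=q_i^{A_{ij}}e_j$; and, for $i\ne j$, $\sum_{r=0}^{1-A_{ij}}(-1)^r\begin{bmatrix}1-A_{ij}\\ r\end{bmatrix}_ie_i^{1-A_{ij}-r}e_je_i^r=0$. Type of a $U_q(\mathfrak{g})$-module: for a finite-dimensional irreducible $U_q(\mathfrak{g})$-module $V$, each $K_i$ acts semisimply and there are $\varepsilon_i\in\{1,-1\}$ such that every eigenvalue of $K_i$ on $V$ is of the form $\varepsilon_iq_i^m$ ($m\in\mathbb{Z}$); $(\varepsilon_i)_{i=1}^n$ is the type of $V$. Type of a $U^{\ge0}$-module: for a finite-dimensional irreducible $U^{\ge0}$-module $V$, each $k_i$ acts semisimply and there are scalars $\alpha_i\in\mathbb{F}^\times$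 such that the set of distinct eigenvalues of $k_i$ on $V$ is $\alpha_i\Delta_i$, where $\Delta_i\subseteq\{q_i^m\mid m\in\mathbb{Z}\}$ and $\Delta_i=\{\theta^{-1}\mid\theta\in\Delta_i\}$; $(\alpha_i)_{i=1}^n$ is the type of $V$. *)

theory Defs
  imports
    "HOL-Analysis.Analysis"
    "HOL-Algebra.QuotRing"
    "HOL-Algebra.Module"
    "HOL-Library.Poly_Mapping"
    "HOL-Computational_Algebra.Polynomial"
begin

section \<open>Unital associative algebras given by generators and relations\<close>

text \<open>A copy of lists, so that words carry the (multiplicatively read) \<open>monoid_add\<close> structure that
  \<open>Poly_Mapping\<close> convolves over: \<open>'g word \<Rightarrow>\<^sub>0 'f\<close> is then the free unital associative \<open>'f\<close>-algebra
  on \<open>'g\<close>.\<close>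

datatype 'g word = Word (letters: "'g list")

instantiation word :: (type) monoid_add
begin

definition zero_word :: "'g word" where "zero_word = Word []"

definition plus_word :: "'g word \<Rightarrow> 'g word \<Rightarrow> 'g word" where
  "plus_word u w = Word (letters u @ letters w)"

instance
  by standard (simp_all add: zero_word_def plus_word_def)

end

definition free_algebra :: "('g word \<Rightarrow>\<^sub>0 'f::field) ring" where
  "free_algebra = \<lparr>carrier = UNIV, mult = (*), one = 1, zero = 0, add = (+)\<rparr>"

definition scal :: "'f \<Rightarrow> ('g word \<Rightarrow>\<^sub>0 'f::field)" where
  "scal c = Poly_Mapping.single 0 c"

definition gen :: "'g \<Rightarrow> ('g word \<Rightarrow>\<^sub>0 'f::field)" where
  "gen g = Poly_Mapping.single (Word [g]) 1"

text \<open>A relation \<open>a = b\<close> is represented by the element \<open>a - b\<close>; ideals in HOL-Algebra are two-sided.\<close>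

definition rel_ideal :: "('g word \<Rightarrow>\<^sub>0 'f::field) set \<Rightarrow> ('g word \<Rightarrow>\<^sub>0 'f) set" where
  "rel_ideal R = genideal free_algebra R"

definition rel_coset :: "('g word \<Rightarrow>\<^sub>0 'f::field) set \<Rightarrow> ('g word \<Rightarrow>\<^sub>0 'f) \<Rightarrow> ('g word \<Rightarrow>\<^sub>0 'f) set" where
  "rel_coset R x = rel_ideal R +>\<^bsub>free_algebra\<^esub> x"

definition presented_algebra ::
  "('g word \<Rightarrow>\<^sub>0 'f::field) set \<Rightarrow> ('f, ('g word \<Rightarrow>\<^sub>0 'f) set) module" where
  "presented_algebra R =
    (let Q = free_algebra Quot rel_ideal R in
     \<lparr>carrier = carrier Q, mult = mult Q, one = one Q, zero = zero Q, add = add Q,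
      smult = (\<lambda>c X. rel_coset R (scal c) \<otimes>\<^bsub>Q\<^esub> X)\<rparr>)"


section \<open>Modules over an algebra\<close>

text \<open>The vector space is the whole type \<open>'v\<close> with scalar multiplication \<open>smul\<close>.\<close>

definition End_alg :: "('f::field \<Rightarrow> 'v::ab_group_add \<Rightarrow> 'v) \<Rightarrow> ('v \<Rightarrow> 'v) ring" where
  "End_alg smul =
    \<lparr>carrier = {f. Vector_Spaces.linear smul smul f}, mult = (\<circ>), one = id,
     zero = (\<lambda>v. 0), add = (\<lambda>f g v. f v + g v)\<rparr>"

text \<open>\<open>\<rho> u v\<close> is the action of \<open>u\<close> on \<open>v\<close>. Extensionality fixes the irrelevant values of \<open>\<rho>\<close> off the
  carrier, so that equality of functions is equality of module structures.\<close>

definition module_structure ::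
  "('f::field \<Rightarrow> 'v::ab_group_add \<Rightarrow> 'v) \<Rightarrow> ('f, 'a) module \<Rightarrow> ('a \<Rightarrow> 'v \<Rightarrow> 'v) \<Rightarrow> bool" where
  "module_structure smul U \<rho> \<longleftrightarrow>
     \<rho> \<in> ring_hom U (End_alg smul) \<and>
     (\<forall>c. \<forall>u\<in>carrier U. \<forall>v. \<rho> (c \<odot>\<^bsub>U\<^esub> u) v = smul c (\<rho> u v)) \<and>
     \<rho> \<in> extensional (carrier U)"

definition submodule_of ::
  "('f::field \<Rightarrow> 'v::ab_group_add \<Rightarrow> 'v) \<Rightarrow> ('f, 'a) module \<Rightarrow> ('a \<Rightarrow> 'v \<Rightarrow> 'v) \<Rightarrow> 'v set \<Rightarrow> bool"
  where
  "submodule_of smul U \<rho> W \<longleftrightarrow>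
     Modules.module.subspace smul W \<and> (\<forall>u\<in>carrier U. \<forall>w\<in>W. \<rho> u w \<in> W)"

definition irreducible_module ::
  "('f::field \<Rightarrow> 'v::ab_group_add \<Rightarrow> 'v) \<Rightarrow> ('f, 'a) module \<Rightarrow> ('a \<Rightarrow> 'v \<Rightarrow> 'v) \<Rightarrow> bool" where
  "irreducible_module smul U \<rho> \<longleftrightarrow>
     (\<exists>v::'v. v \<noteq> 0) \<and> (\<forall>W. submodule_of smul U \<rho> W \<longrightarrow> W = {0} \<or> W = UNIV)"

definition finite_dim :: "('f::field \<Rightarrow> 'v::ab_group_add \<Rightarrow> 'v) \<Rightarrow> bool" where
  "finite_dim smul \<longleftrightarrow> (\<exists>B. finite B \<and> Modules.module.span smul B = UNIV)"

definition eigenvalues ::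
  "('f::field \<Rightarrow> 'v::ab_group_add \<Rightarrow> 'v) \<Rightarrow> ('v \<Rightarrow> 'v) \<Rightarrow> 'f set" where
  "eigenvalues smul T = {\<theta>. \<exists>v. v \<noteq> 0 \<and> T v = smul \<theta> v}"

text \<open>Over an algebraically closed field, an operator on a finite-dimensional space is semisimple iff
  it is diagonalizable, i.e. its eigenvectors span the space.\<close>

definition acts_semisimply ::
  "('f::field \<Rightarrow> 'v::ab_group_add \<Rightarrow> 'v) \<Rightarrow> ('v \<Rightarrow> 'v) \<Rightarrow> bool" where
  "acts_semisimply smul T \<longleftrightarrow>
     Modules.module.span smul {v. \<exists>\<theta>. T v = smul \<theta> v} = UNIV"


section \<open>Generalized Cartan matrices of affine type\<close>

definition gen_cartan_matrix :: "int ^ 'n::finite ^ 'n \<Rightarrow> bool" where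
  "gen_cartan_matrix A \<longleftrightarrow>
     (\<forall>i. A $ i $ i = 2) \<and>
     (\<forall>i j. i \<noteq> j \<longrightarrow> A $ i $ j \<le> 0) \<and>
     (\<forall>i j. A $ i $ j = 0 \<longrightarrow> A $ j $ i = 0)"

definition indecomposable_matrix :: "int ^ 'n::finite ^ 'n \<Rightarrow> bool" where
  "indecomposable_matrix A \<longleftrightarrow>
     \<not> (\<exists>S. S \<noteq> {} \<and> S \<noteq> UNIV \<and> (\<forall>i\<in>S. \<forall>j\<in>-S. A $ i $ j = 0 \<and> A $ j $ i = 0))"

definition affine_type :: "int ^ 'n::finite ^ 'n \<Rightarrow> bool" where
  "affine_type A \<longleftrightarrow>
     gen_cartan_matrix A \<and> indecomposable_matrix A \<and>
     rank (map_matrix real_of_int A) + 1 = CARD('n) \<and>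
     (\<exists>u :: real ^ 'n. (\<forall>i. u $ i > 0) \<and> map_matrix real_of_int A *v u = 0)"

text \<open>The existence of such an \<open>s\<close> is the symmetrizability of \<open>A\<close>.\<close>

definition symmetrizer :: "int ^ 'n::finite ^ 'n \<Rightarrow> ('n \<Rightarrow> nat) \<Rightarrow> bool" where
  "symmetrizer A s \<longleftrightarrow>
     (\<forall>i. s i > 0) \<and> Gcd (range s) = 1 \<and>
     (\<forall>i j. int (s i) * A $ i $ j = int (s j) * A $ j $ i)"


section \<open>The quantum affine algebra and its nonnegative part\<close>

definition qint :: "'f::field \<Rightarrow> nat \<Rightarrow> 'f" where
  "qint x m = (x powi int m - x powi (- int m)) / (x - inverse x)"

definition qfact :: "'f::field \<Rightarrow> nat \<Rightarrow> 'f" where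
  "qfact x m = (\<Prod>k=1..m. qint x k)"

definition qbinom :: "'f::field \<Rightarrow> nat \<Rightarrow> nat \<Rightarrow> 'f" where
  "qbinom x m r = qfact x m / (qfact x r * qfact x (m - r))"

text \<open>The left-hand side of the quantum Serre relation, where \<open>x\<close> plays the role of \<open>q\<^sub>i\<close>
  and \<open>a\<close> that of \<open>A\<^sub>i\<^sub>j\<close>, which is \<open>\<le> 0\<close> whenever this is used.\<close>

definition qserre ::
  "'f::field \<Rightarrow> int \<Rightarrow> ('g word \<Rightarrow>\<^sub>0 'f) \<Rightarrow> ('g word \<Rightarrow>\<^sub>0 'f) \<Rightarrow> ('g word \<Rightarrow>\<^sub>0 'f)" where
  "qserre x a X Y =
     (let m = nat (1 - a) in
      \<Sum>r=0..m. scal ((-1) ^ r * qbinom x m r) * X ^ (m - r) * Y * X ^ r)"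

datatype 'n uq_gen = UE 'n | UF 'n | UK 'n | UKinv 'n

definition Uq_relations ::
  "int ^ 'n::finite ^ 'n \<Rightarrow> ('n \<Rightarrow> nat) \<Rightarrow> 'f::field \<Rightarrow> ('n uq_gen word \<Rightarrow>\<^sub>0 'f) set" where
  "Uq_relations A s q =
     {gen (UK i) * gen (UKinv i) - 1 | i. True} \<union>
     {gen (UKinv i) * gen (UK i) - 1 | i. True} \<union>
     {gen (UK i) * gen (UK j) - gen (UK j) * gen (UK i) | i j. True} \<union>
     {gen (UK i) * gen (UE j) * gen (UKinv i) - scal ((q ^ s i) powi (A $ i $ j)) * gen (UE j)
        | i j. True} \<union>
     {gen (UK i) * gen (UF j) * gen (UKinv i) - scal ((q ^ s i) powi (- (A $ i $ j))) * gen (UF j)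
        | i j. True} \<union>
     {gen (UE i) * gen (UF j) - gen (UF j) * gen (UE i) -
        (if i = j then scal (1 / (q ^ s i - inverse (q ^ s i))) * (gen (UK i) - gen (UKinv i)) else 0)
        | i j. True} \<union>
     {qserre (q ^ s i) (A $ i $ j) (gen (UE i)) (gen (UE j)) | i j. i \<noteq> j} \<union>
     {qserre (q ^ s i) (A $ i $ j) (gen (UF i)) (gen (UF j)) | i j. i \<noteq> j}"

definition Uq ::
  "int ^ 'n::finite ^ 'n \<Rightarrow> ('n \<Rightarrow> nat) \<Rightarrow> 'f::field \<Rightarrow> ('f, ('n uq_gen word \<Rightarrow>\<^sub>0 'f) set) module"
  where
  "Uq A s q = presented_algebra (Uq_relations A s q)"

definition Uq_gen ::
  "int ^ 'n::finite ^ 'n \<Rightarrow> ('n \<Rightarrow> nat) \<Rightarrow> 'f::field \<Rightarrow> 'n uq_gen \<Rightarrow> ('n uq_gen word \<Rightarrow>\<^sub>0 'f) set" where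
  "Uq_gen A s q g = rel_coset (Uq_relations A s q) (gen g)"

datatype 'n ugeq0_gen = Ue 'n | Uk 'n | Ukinv 'n

definition Ugeq0_relations ::
  "int ^ 'n::finite ^ 'n \<Rightarrow> ('n \<Rightarrow> nat) \<Rightarrow> 'f::field \<Rightarrow> ('n ugeq0_gen word \<Rightarrow>\<^sub>0 'f) set" where
  "Ugeq0_relations A s q =
     {gen (Uk i) * gen (Ukinv i) - 1 | i. True} \<union>
     {gen (Ukinv i) * gen (Uk i) - 1 | i. True} \<union>
     {gen (Uk i) * gen (Uk j) - gen (Uk j) * gen (Uk i) | i j. True} \<union>
     {gen (Uk i) * gen (Ue j) * gen (Ukinv i) - scal ((q ^ s i) powi (A $ i $ j)) * gen (Ue j)
        | i j. True} \<union>
     {qserre (q ^ s i) (A $ i $ j) (gen (Ue i)) (gen (Ue j)) | i j. i \<noteq> j}"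

definition Ugeq0 ::
  "int ^ 'n::finite ^ 'n \<Rightarrow> ('n \<Rightarrow> nat) \<Rightarrow> 'f::field \<Rightarrow> ('f, ('n ugeq0_gen word \<Rightarrow>\<^sub>0 'f) set) module"
  where
  "Ugeq0 A s q = presented_algebra (Ugeq0_relations A s q)"

definition Ugeq0_gen ::
  "int ^ 'n::finite ^ 'n \<Rightarrow> ('n \<Rightarrow> nat) \<Rightarrow> 'f::field \<Rightarrow> 'n ugeq0_gen \<Rightarrow> ('n ugeq0_gen word \<Rightarrow>\<^sub>0 'f) set"
  where
  "Ugeq0_gen A s q g = rel_coset (Ugeq0_relations A s q) (gen g)"


section \<open>Types of modules\<close>

definition Uq_type ::
  "('f::field \<Rightarrow> 'v::ab_group_add \<Rightarrow> 'v) \<Rightarrow> int ^ 'n::finite ^ 'n \<Rightarrow> ('n \<Rightarrow> nat) \<Rightarrow> 'f \<Rightarrow>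
   (('n uq_gen word \<Rightarrow>\<^sub>0 'f) set \<Rightarrow> 'v \<Rightarrow> 'v) \<Rightarrow> ('n \<Rightarrow> 'f) \<Rightarrow> bool" where
  "Uq_type smul A s q \<rho> \<epsilon> \<longleftrightarrow>
     (\<forall>i. \<epsilon> i \<in> {1, -1} \<and>
          acts_semisimply smul (\<rho> (Uq_gen A s q (UK i))) \<and>
          eigenvalues smul (\<rho> (Uq_gen A s q (UK i))) \<subseteq> {\<epsilon> i * (q ^ s i) powi m | m. True})"

definition Ugeq0_type ::
  "('f::field \<Rightarrow> 'v::ab_group_add \<Rightarrow> 'v) \<Rightarrow> int ^ 'n::finite ^ 'n \<Rightarrow> ('n \<Rightarrow> nat) \<Rightarrow> 'f \<Rightarrow>
   (('n ugeq0_gen word \<Rightarrow>\<^sub>0 'f) set \<Rightarrow> 'v \<Rightarrow> 'v) \<Rightarrow> ('n \<Rightarrow> 'f) \<Rightarrow> bool" where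
  "Ugeq0_type smul A s q \<sigma> \<alpha> \<longleftrightarrow>
     (\<forall>i. \<alpha> i \<noteq> 0 \<and>
          acts_semisimply smul (\<sigma> (Ugeq0_gen A s q (Uk i))) \<and>
          (\<exists>\<Delta>. eigenvalues smul (\<sigma> (Ugeq0_gen A s q (Uk i))) = (\<lambda>\<theta>. \<alpha> i * \<theta>) ` \<Delta> \<and>
               \<Delta> \<subseteq> {(q ^ s i) powi m | m. True} \<and>
               \<Delta> = inverse ` \<Delta>))"

text \<open>The operators \<open>E\<^sub>i - \<epsilon>\<^sub>i \<alpha>\<^sub>i\<^sup>-\<^sup>1 e\<^sub>i\<close>, \<open>K\<^sub>i - \<epsilon>\<^sub>i \<alpha>\<^sub>i\<^sup>-\<^sup>1 k\<^sub>i\<close> and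
  \<open>K\<^sub>i\<^sup>-\<^sup>1 - \<epsilon>\<^sub>i \<alpha>\<^sub>i k\<^sub>i\<^sup>-\<^sup>1\<close> vanish.\<close>

definition compatible ::
  "('f::field \<Rightarrow> 'v::ab_group_add \<Rightarrow> 'v) \<Rightarrow> int ^ 'n::finite ^ 'n \<Rightarrow> ('n \<Rightarrow> nat) \<Rightarrow> 'f \<Rightarrow>
   ('n \<Rightarrow> 'f) \<Rightarrow> ('n \<Rightarrow> 'f) \<Rightarrow>
   (('n uq_gen word \<Rightarrow>\<^sub>0 'f) set \<Rightarrow> 'v \<Rightarrow> 'v) \<Rightarrow>
   (('n ugeq0_gen word \<Rightarrow>\<^sub>0 'f) set \<Rightarrow> 'v \<Rightarrow> 'v) \<Rightarrow> bool" where
  "compatible smul A s q \<epsilon> \<alpha> \<rho> \<sigma> \<longleftrightarrow>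
     (\<forall>i v.
        \<rho> (Uq_gen A s q (UE i)) v
          - smul (\<epsilon> i * inverse (\<alpha> i)) (\<sigma> (Ugeq0_gen A s q (Ue i)) v) = 0 \<and>
        \<rho> (Uq_gen A s q (UK i)) v
          - smul (\<epsilon> i * inverse (\<alpha> i)) (\<sigma> (Ugeq0_gen A s q (Uk i)) v) = 0 \<and>
        \<rho> (Uq_gen A s q (UKinv i)) v
          - smul (\<epsilon> i * \<alpha> i) (\<sigma> (Ugeq0_gen A s q (Ukinv i)) v) = 0)"

end

theory Submission
  imports Defs
begin

text \<open>The module structure is the rescaling \<open>e\<^sub>i = \<epsilon>\<^sub>i \<alpha>\<^sub>i E\<^sub>i\<close>, \<open>k\<^sub>i = \<epsilon>\<^sub>i \<alpha>\<^sub>i K\<^sub>i\<close>; the point is that a subspace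
  \<open>W\<close> stable under all \<open>E\<^sub>i\<close> and \<open>K\<^sub>i\<close> is stable under all \<open>F\<^sub>i\<close>. For each \<open>i\<close>, the map \<open>E\<^sub>i\<^sup>m\<close> is injective
  from weight \<open>- m\<close> to weight \<open>m\<close>, so the \<open>K\<^sub>i\<close>-weights of a basis of \<open>W\<close> have a nonnegative sum, with
  equality only if every \<open>E\<^sub>i\<^sup>m\<close> maps the weight \<open>- m\<close> part of \<open>W\<close> onto the weight \<open>m\<close> part, and in that case
  \<open>W\<close> is \<open>F\<^sub>i\<close>-stable. Since \<open>A\<close> is affine, a positive combination of the weights for the various \<open>i\<close> is
  central, and it vanishes by symmetry of the weights of the whole module; this forces equality.\<close>

section \<open>Modules over presented algebras\<close>

text \<open>The obstacle is that \<open>W\<close> is not known to be a module over any of the rank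
  one subalgebras, so their representation theory says nothing about \<open>W\<close> directly; what
  \<open>W\<close> inherits from the ambient space is only the injectivity of powers of
  \<open>E i\<close>. One index alone cannot decide the matter: for a Cartan matrix of finite type,
  the line through a highest weight vector of a nontrivial irreducible module is stable under all
  \<open>E i\<close> and \<open>K i\<close>, and its weights are nonnegative and not all zero. What
  excludes this is a linear dependency between the inequalities for different \<open>i\<close>. Its
  coefficients are \<open>u i * s i\<close>: the symmetrizer \<open>s\<close> turns the right null
  vector \<open>u\<close> of \<open>A\<close> into a left one, so the weighted sum does not change
  when a column of \<open>A\<close> is added to or subtracted from the weights, that is, under every
  \<open>E j\<close> and \<open>F j\<close>. The coefficients may stay real, because the sum is only
  used as an additive function of integer weights; no central element of the algebra has to be
  formed.\<close>

text \<open>A fresh locale: names introduced inside \<open>vector_space\<close> itself would be shadowed by their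
  instances for \<open>real_vector\<close>, whose prefix is optional.\<close>

locale vspace = vector_space smul
  for smul :: "'f::field \<Rightarrow> 'v::ab_group_add \<Rightarrow> 'v" (infixr "\<cdot>" 75)
begin

text \<open>Evaluation of a noncommutative polynomial at operators. With \<open>foldr\<close> the
  last letter acts first, so concatenation of words becomes composition.\<close>

definition free_eval :: "('g \<Rightarrow> 'v \<Rightarrow> 'v) \<Rightarrow> ('g word \<Rightarrow>\<^sub>0 'f) \<Rightarrow> 'v \<Rightarrow> 'v" where
  "free_eval \<phi> p v = (\<Sum>w\<in>Poly_Mapping.keys p. Poly_Mapping.lookup p w \<cdot> foldr \<phi> (letters w) v)"

lemma free_eval_superset:
  assumes "finite S" "Poly_Mapping.keys p \<subseteq> S"
  shows "free_eval \<phi> p v = (\<Sum>w\<in>S. Poly_Mapping.lookup p w \<cdot> foldr \<phi> (letters w) v)"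
  unfolding free_eval_def using assms
  by (intro sum.mono_neutral_left) (auto simp: in_keys_iff)

lemma free_eval_add: "free_eval \<phi> (p + r) v = free_eval \<phi> p v + free_eval \<phi> r v"
proof -
  let ?S = "Poly_Mapping.keys p \<union> Poly_Mapping.keys r"
  have "Poly_Mapping.keys (p + r) \<subseteq> ?S"
    by (rule Poly_Mapping.keys_add)
  then show ?thesis
    by (simp add: free_eval_superset[where S = ?S] lookup_add scale_left_distrib sum.distrib)
qed

lemma free_eval_single:
  "free_eval \<phi> (Poly_Mapping.single w c) v = c \<cdot> foldr \<phi> (letters w) v"
  by (simp add: free_eval_def)

lemma free_eval_zero [simp]: "free_eval \<phi> 0 v = 0"
  by (simp add: free_eval_def)

lemma free_eval_diff: "free_eval \<phi> (p - r) v = free_eval \<phi> p v - free_eval \<phi> r v"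
  using free_eval_add[of \<phi> "p - r" r v] by simp

lemma free_eval_sum: "free_eval \<phi> (sum f S) v = (\<Sum>x\<in>S. free_eval \<phi> (f x) v)"
  by (induction S rule: infinite_finite_induct) (auto simp: free_eval_add)

lemma free_eval_one [simp]: "free_eval \<phi> 1 v = v"
  unfolding single_one[symmetric] by (simp add: free_eval_single zero_word_def)

lemma free_eval_scal [simp]: "free_eval \<phi> (scal c) v = c \<cdot> v"
  by (simp add: free_eval_single scal_def zero_word_def)

lemma free_eval_gen [simp]: "free_eval \<phi> (gen g) = \<phi> g"
  by (rule ext) (simp add: free_eval_single gen_def)

end

lemma poly_mapping_eq_sum_single:
  "p = (\<Sum>w\<in>Poly_Mapping.keys p. Poly_Mapping.single w (Poly_Mapping.lookup p w))"
proof (rule poly_mapping_eqI)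
  fix k
  have "(\<Sum>w\<in>Poly_Mapping.keys p. if w = k then Poly_Mapping.lookup p w else 0)
      = (if k \<in> Poly_Mapping.keys p then Poly_Mapping.lookup p k else 0)"
    by (simp add: sum.delta)
  then show "Poly_Mapping.lookup p k = Poly_Mapping.lookup
      (\<Sum>w\<in>Poly_Mapping.keys p. Poly_Mapping.single w (Poly_Mapping.lookup p w)) k"
    by (auto simp: lookup_sum lookup_single when_def in_keys_iff)
qed

lemma free_algebra_induct [case_names single add]:
  fixes p :: "'g word \<Rightarrow>\<^sub>0 'f::field"
  assumes "\<And>w c. P (Poly_Mapping.single w c)"
    and add: "\<And>p r. P p \<Longrightarrow> P r \<Longrightarrow> P (p + r)"
  shows "P p"
proof -
  have "P (\<Sum>w\<in>S. Poly_Mapping.single w (Poly_Mapping.lookup p w))" if "finite S" for S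
    using that
  proof induction
    \<comment> \<open>The empty sum is itself \<open>single 0 0\<close>, so the induction rule needs
      no case for zero.\<close>
    case empty
    then show ?case using assms(1)[of 0 0] by simp
  qed (simp add: assms)
  then show ?thesis
    by (subst poly_mapping_eq_sum_single) simp
qed

lemma single_Word_Cons:
  "Poly_Mapping.single (Word (g # gs)) c = gen g * Poly_Mapping.single (Word gs) (c::'f::field)"
  by (simp add: gen_def mult_single plus_word_def)

lemma single_eq_scal_mult:
  "Poly_Mapping.single w c = scal c * Poly_Mapping.single w (1::'f::field)"
  by (simp add: scal_def mult_single)

context vspace
begin

abbreviation lin :: "('v \<Rightarrow> 'v) \<Rightarrow> bool" where
  "lin \<equiv> Vector_Spaces.linear smul smul"

lemma linI:
  assumes "\<And>x y. f (x + y) = f x + f y" "\<And>c x. f (c \<cdot> x) = c \<cdot> f x"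
  shows "lin f"
  by unfold_locales (auto simp: assms scale_right_distrib scale_left_distrib)

lemma lin_add: "lin f \<Longrightarrow> f (x + y) = f x + f y"
  by (simp add: Vector_Spaces.linear_iff)

lemma lin_scale: "lin f \<Longrightarrow> f (c \<cdot> x) = c \<cdot> f x"
  by (simp add: Vector_Spaces.linear_iff)

lemma lin_zero: "lin f \<Longrightarrow> f 0 = 0"
  using lin_scale[of f 0 0] by simp

lemma lin_sum: "lin f \<Longrightarrow> f (sum g S) = (\<Sum>x\<in>S. f (g x))"
  by (induction S rule: infinite_finite_induct) (auto simp: lin_add lin_zero)

lemma lin_diff: "lin f \<Longrightarrow> f (x - y) = f x - f y"
  using lin_add[of f "x - y" y] by simp

lemma lin_foldr:
  assumes "\<And>g. lin (\<phi> g)"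
  shows "lin (foldr \<phi> gs)"
proof (rule linI)
  show "foldr \<phi> gs (x + y) = foldr \<phi> gs x + foldr \<phi> gs y" for x y
    by (induction gs) (simp_all add: lin_add[OF assms])
  show "foldr \<phi> gs (c \<cdot> x) = c \<cdot> foldr \<phi> gs x" for c x
    by (induction gs) (simp_all add: lin_scale[OF assms])
qed

lemma lin_free_eval:
  assumes "\<And>g. lin (\<phi> g)"
  shows "lin (free_eval \<phi> p)"
  by (rule linI) (simp_all add: free_eval_def lin_add[OF lin_foldr[OF assms]]
      lin_scale[OF lin_foldr[OF assms]] scale_right_distrib sum.distrib scale_sum_right
      mult.commute)

lemma free_eval_mult:
  assumes lin: "\<And>g. lin (\<phi> g)"
  shows "free_eval \<phi> (p * r) v = free_eval \<phi> p (free_eval \<phi> r v)"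
proof (induction p rule: free_algebra_induct)
  case (single w c)
  show ?case
  proof (induction r rule: free_algebra_induct)
    case (single w' c')
    then show ?case
      by (simp add: mult_single free_eval_single plus_word_def lin_scale[OF lin_foldr[OF lin]])
  next
    case (add p r)
    then show ?case
      by (simp add: distrib_left free_eval_add lin_add[OF lin_free_eval[OF lin]])
  qed
next
  case (add p r)
  then show ?case by (simp add: distrib_right free_eval_add)
qed

lemma free_eval_power:
  assumes lin: "\<And>g. lin (\<phi> g)"
  shows "free_eval \<phi> (p ^ n) v = (free_eval \<phi> p ^^ n) v"
  by (induction n) (simp_all add: free_eval_mult[OF lin])

lemma free_eval_qserre:
  assumes lin: "\<And>g. lin (\<phi> g)"
  shows "free_eval \<phi> (qserre x a (gen g) (gen h)) v =
    (\<Sum>r = 0..nat (1 - a). ((-1) ^ r * qbinom x (nat (1 - a)) r) \<cdot>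
      (\<phi> g ^^ (nat (1 - a) - r)) (\<phi> h ((\<phi> g ^^ r) v)))"
  by (simp add: qserre_def Let_def free_eval_sum free_eval_mult[OF lin] free_eval_power[OF lin])

end

section \<open>The quotient of the free algebra by its relations\<close>

lemma free_algebra_simps [simp]:
  "carrier free_algebra = UNIV" "mult free_algebra = (*)" "one free_algebra = 1"
  "zero free_algebra = 0" "add free_algebra = (+)"
  by (simp_all add: free_algebra_def)

lemma ring_free_algebra: "ring (free_algebra :: ('g word \<Rightarrow>\<^sub>0 'f::field) ring)"
proof (rule ringI)
  show "abelian_group (free_algebra :: ('g word \<Rightarrow>\<^sub>0 'f) ring)"
  proof (rule abelian_groupI)
    fix x :: "'g word \<Rightarrow>\<^sub>0 'f"
    show "\<exists>y\<in>carrier free_algebra. y \<oplus>\<^bsub>free_algebra\<^esub> x = \<zero>\<^bsub>free_algebra\<^esub>"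
      by (rule bexI[of _ "- x"]) simp_all
  qed (simp_all add: ac_simps)
  show "Group.monoid (free_algebra :: ('g word \<Rightarrow>\<^sub>0 'f) ring)"
    by (rule monoidI) (simp_all add: mult.assoc)
qed (simp_all add: distrib_left distrib_right)

lemma ideal_rel_ideal: "ideal (rel_ideal R) free_algebra"
  unfolding rel_ideal_def by (rule ring.genideal_ideal[OF ring_free_algebra]) simp

lemma subset_rel_ideal: "R \<subseteq> rel_ideal R"
  unfolding rel_ideal_def by (rule ring.genideal_self[OF ring_free_algebra]) simp

lemma rel_coset_eq_iff: "rel_coset R x = rel_coset R y \<longleftrightarrow> x - y \<in> rel_ideal R"
proof -
  interpret ideal "rel_ideal R" free_algebra by (rule ideal_rel_ideal)
  have [simp]: "x \<ominus>\<^bsub>free_algebra\<^esub> y = x - y"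
  proof -
    have "\<ominus>\<^bsub>free_algebra\<^esub> y = - y"
      by (rule minus_equality) simp_all
    then show ?thesis by (simp add: a_minus_def)
  qed
  show ?thesis
    unfolding rel_coset_def
    using quotient_eq_iff_same_a_r_cos[OF ideal_axioms, of x y] by auto
qed

lemma presented_algebra_simps:
  "carrier (presented_algebra R) = range (rel_coset R)"
  "rel_coset R x \<otimes>\<^bsub>presented_algebra R\<^esub> rel_coset R y = rel_coset R (x * y)"
  "rel_coset R x \<oplus>\<^bsub>presented_algebra R\<^esub> rel_coset R y = rel_coset R (x + y)"
  "\<one>\<^bsub>presented_algebra R\<^esub> = rel_coset R 1"
  "c \<odot>\<^bsub>presented_algebra R\<^esub> rel_coset R x = rel_coset R (scal c * x)"
proof -
  interpret ideal "rel_ideal R" free_algebra by (rule ideal_rel_ideal)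
  note hom = rcos_ring_hom
  show "carrier (presented_algebra R) = range (rel_coset R)"
    by (auto simp: presented_algebra_def Let_def FactRing_def A_RCOSETS_def' rel_coset_def)
  show "rel_coset R x \<otimes>\<^bsub>presented_algebra R\<^esub> rel_coset R y = rel_coset R (x * y)" for x y
    using ring_hom_mult[OF hom, of x y]
    by (simp add: presented_algebra_def Let_def rel_coset_def)
  show "rel_coset R x \<oplus>\<^bsub>presented_algebra R\<^esub> rel_coset R y = rel_coset R (x + y)" for x y
    using ring_hom_add[OF hom, of x y]
    by (simp add: presented_algebra_def Let_def rel_coset_def)
  show "\<one>\<^bsub>presented_algebra R\<^esub> = rel_coset R 1"
    using ring_hom_one[OF hom]
    by (simp add: presented_algebra_def Let_def rel_coset_def)
  show "c \<odot>\<^bsub>presented_algebra R\<^esub> rel_coset R x = rel_coset R (scal c * x)"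
    using ring_hom_mult[OF hom, of "scal c" x]
    by (simp add: presented_algebra_def Let_def rel_coset_def)
qed

section \<open>Module structures as operators for the generators\<close>

context vspace
begin

text \<open>The relations are hidden in the second conjunct: its left side depends only on the coset
  of \<open>p\<close>, so it forces evaluation at the generators to be constant on cosets.\<close>

lemma module_structure_presented_iff:
  "module_structure smul (presented_algebra R) \<sigma> \<longleftrightarrow>
    (\<forall>g. lin (\<sigma> (rel_coset R (gen g)))) \<and>
    (\<forall>p. \<sigma> (rel_coset R p) = free_eval (\<lambda>g. \<sigma> (rel_coset R (gen g))) p) \<and>
    \<sigma> \<in> extensional (range (rel_coset R))" (is "_ \<longleftrightarrow> ?rhs")
proof
  assume "module_structure smul (presented_algebra R) \<sigma>"
  then have hom: "\<sigma> \<in> ring_hom (presented_algebra R) (End_alg smul)"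
    and smul: "\<And>c p v. \<sigma> (rel_coset R (scal c * p)) v = c \<cdot> \<sigma> (rel_coset R p) v"
    and ext: "\<sigma> \<in> extensional (range (rel_coset R))"
    by (auto simp: module_structure_def presented_algebra_simps)
  have lin: "lin (\<sigma> (rel_coset R p))" for p
    using ring_hom_closed[OF hom, of "rel_coset R p"]
    by (auto simp: presented_algebra_simps End_alg_def)
  have mult: "\<sigma> (rel_coset R (p * r)) = \<sigma> (rel_coset R p) \<circ> \<sigma> (rel_coset R r)" for p r
    using ring_hom_mult[OF hom, of "rel_coset R p" "rel_coset R r"]
    by (simp add: presented_algebra_simps End_alg_def)
  have hom_add: "\<sigma> (rel_coset R (p + r)) = (\<lambda>v. \<sigma> (rel_coset R p) v + \<sigma> (rel_coset R r) v)" for p r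
    using ring_hom_add[OF hom, of "rel_coset R p" "rel_coset R r"]
    by (simp add: presented_algebra_simps End_alg_def)
  have one: "\<sigma> (rel_coset R 1) = id"
    using ring_hom_one[OF hom]
    by (simp add: presented_algebra_simps End_alg_def)
  let ?\<phi> = "\<lambda>g. \<sigma> (rel_coset R (gen g))"
  have word: "\<sigma> (rel_coset R (Poly_Mapping.single (Word gs) 1)) = foldr ?\<phi> gs" for gs
    by (induction gs)
      (simp_all add: single_Word_Cons mult one zero_word_def[symmetric] fun_eq_iff)
  have "\<sigma> (rel_coset R p) v = free_eval ?\<phi> p v" for p v
  proof (induction p rule: free_algebra_induct)
    case (single w c)
    then show ?case
      using word[of "letters w"]
      by (subst single_eq_scal_mult) (simp add: smul free_eval_mult[OF lin] free_eval_single)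
  next
    case (add p r)
    then show ?case by (simp add: hom_add free_eval_add)
  qed
  then show ?rhs using lin ext by blast
next
  assume rhs: ?rhs
  define \<phi> where "\<phi> g = \<sigma> (rel_coset R (gen g))" for g
  have lin: "\<And>g. lin (\<phi> g)" and eval: "\<And>p. \<sigma> (rel_coset R p) = free_eval \<phi> p"
    using rhs unfolding \<phi>_def by blast+
  have "\<sigma> \<in> ring_hom (presented_algebra R) (End_alg smul)"
  proof (rule ring_hom_memI)
    fix X Y assume "X \<in> carrier (presented_algebra R)" "Y \<in> carrier (presented_algebra R)"
    then obtain p r where XY: "X = rel_coset R p" "Y = rel_coset R r"
      by (auto simp: presented_algebra_simps)
    show "\<sigma> (X \<otimes>\<^bsub>presented_algebra R\<^esub> Y) = \<sigma> X \<otimes>\<^bsub>End_alg smul\<^esub> \<sigma> Y"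
      unfolding XY presented_algebra_simps eval
      by (rule ext) (simp add: End_alg_def free_eval_mult[OF lin])
    show "\<sigma> (X \<oplus>\<^bsub>presented_algebra R\<^esub> Y) = \<sigma> X \<oplus>\<^bsub>End_alg smul\<^esub> \<sigma> Y"
      unfolding XY presented_algebra_simps eval
      by (rule ext) (simp add: End_alg_def free_eval_add)
  next
    fix X assume "X \<in> carrier (presented_algebra R)"
    then obtain p where X: "X = rel_coset R p"
      by (auto simp: presented_algebra_simps)
    show "\<sigma> X \<in> carrier (End_alg smul)"
      unfolding X eval by (simp add: End_alg_def lin_free_eval[OF lin])
  next
    show "\<sigma> \<one>\<^bsub>presented_algebra R\<^esub> = \<one>\<^bsub>End_alg smul\<^esub>"
      unfolding presented_algebra_simps eval by (rule ext) (simp add: End_alg_def)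
  qed
  moreover have "\<sigma> (c \<odot>\<^bsub>presented_algebra R\<^esub> X) v = c \<cdot> \<sigma> X v"
    if X: "X \<in> carrier (presented_algebra R)" for c X v
  proof -
    obtain p where "X = rel_coset R p"
      using X by (auto simp: presented_algebra_simps)
    then show ?thesis
      by (simp only: presented_algebra_simps eval free_eval_mult[OF lin] free_eval_scal)
  qed
  moreover have "\<sigma> \<in> extensional (carrier (presented_algebra R))"
    using rhs unfolding presented_algebra_simps by blast
  ultimately show "module_structure smul (presented_algebra R) \<sigma>"
    unfolding module_structure_def by blast
qed

lemma presented_module_relation:
  assumes "module_structure smul (presented_algebra R) \<sigma>" and "r \<in> R"
  shows "free_eval (\<lambda>g. \<sigma> (rel_coset R (gen g))) r v = 0"
proof -
  have "rel_coset R r = rel_coset R 0"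
    using assms(2) subset_rel_ideal by (auto simp: rel_coset_eq_iff)
  moreover have "\<sigma> (rel_coset R p) = free_eval (\<lambda>g. \<sigma> (rel_coset R (gen g))) p" for p
    using assms(1) unfolding module_structure_presented_iff by blast
  ultimately show ?thesis by (metis free_eval_zero)
qed

lemma ideal_free_eval_kernel:
  assumes lin: "\<And>g. lin (\<phi> g)"
  shows "ideal {p. \<forall>v. free_eval \<phi> p v = 0} free_algebra"
proof (rule idealI[OF ring_free_algebra])
  have inv_eq: "inv\<^bsub>add_monoid free_algebra\<^esub> p = - p" for p :: "'g word \<Rightarrow>\<^sub>0 'f"
  proof -
    interpret ring "free_algebra :: ('g word \<Rightarrow>\<^sub>0 'f) ring" by (rule ring_free_algebra)
    show ?thesis
      using minus_equality[of "- p" p] by (simp add: a_inv_def)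
  qed
  show "subgroup {p. \<forall>v. free_eval \<phi> p v = 0} (add_monoid free_algebra)"
  proof (rule subgroup.intro)
    fix p assume "p \<in> {p. \<forall>v. free_eval \<phi> p v = 0}"
    then show "inv\<^bsub>add_monoid free_algebra\<^esub> p \<in> {p. \<forall>v. free_eval \<phi> p v = 0}"
      unfolding inv_eq using free_eval_diff[of \<phi> 0 p] by simp
  qed (auto simp: free_eval_add)
qed (auto simp: free_eval_mult[OF lin] lin_zero[OF lin_free_eval[OF lin]])

text \<open>The universal property: the polynomials that evaluate to the zero operator form a
  two-sided ideal containing \<open>R\<close>, hence they contain
  \<open>rel_ideal R\<close>.\<close>

lemma presented_module_exists:
  assumes lin: "\<And>g. lin (\<phi> g)" and rel: "\<And>r v. r \<in> R \<Longrightarrow> free_eval \<phi> r v = 0"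
  obtains \<sigma> where "module_structure smul (presented_algebra R) \<sigma>"
    and "\<And>g. \<sigma> (rel_coset R (gen g)) = \<phi> g"
proof -
  have ker: "rel_ideal R \<subseteq> {p. \<forall>v. free_eval \<phi> p v = 0}"
    unfolding rel_ideal_def
    by (rule ring.genideal_minimal[OF ring_free_algebra ideal_free_eval_kernel[OF lin]])
      (use rel in auto)
  \<comment> \<open>Any representative of the coset will do, as evaluation is constant on cosets;
    \<open>restrict\<close> provides extensionality.\<close>
  define \<sigma> where "\<sigma> = restrict (\<lambda>X. free_eval \<phi> (SOME p. X = rel_coset R p)) (range (rel_coset R))"
  have \<sigma>: "\<sigma> (rel_coset R p) = free_eval \<phi> p" for p
  proof
    fix v
    define p' where "p' = (SOME p'. rel_coset R p = rel_coset R p')"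
    have "rel_coset R p = rel_coset R p'"
      unfolding p'_def by (rule someI[of _ p]) simp
    then have "free_eval \<phi> (p - p') v = 0"
      using ker by (auto simp: rel_coset_eq_iff)
    then show "\<sigma> (rel_coset R p) v = free_eval \<phi> p v"
      by (simp add: \<sigma>_def p'_def free_eval_diff)
  qed
  have "module_structure smul (presented_algebra R) \<sigma>"
    unfolding module_structure_presented_iff \<sigma> by (simp add: lin) (simp add: \<sigma>_def)
  then show thesis using that \<sigma> by simp
qed

lemma presented_module_unique:
  assumes "module_structure smul (presented_algebra R) \<sigma>"
    and "module_structure smul (presented_algebra R) \<sigma>'"
    and "\<And>g. \<sigma> (rel_coset R (gen g)) = \<sigma>' (rel_coset R (gen g))"
  shows "\<sigma> = \<sigma>'"
proof (rule extensionalityI)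
  show "\<sigma> \<in> extensional (range (rel_coset R))" "\<sigma>' \<in> extensional (range (rel_coset R))"
    using assms(1,2) unfolding module_structure_presented_iff by blast+
  show "\<sigma> X = \<sigma>' X" if X: "X \<in> range (rel_coset R)" for X
  proof -
    obtain p where "X = rel_coset R p"
      using X by blast
    moreover have "\<sigma> (rel_coset R p) = free_eval (\<lambda>g. \<sigma> (rel_coset R (gen g))) p"
      "\<sigma>' (rel_coset R p) = free_eval (\<lambda>g. \<sigma>' (rel_coset R (gen g))) p"
      using assms(1,2) unfolding module_structure_presented_iff by blast+
    ultimately show ?thesis
      using assms(3) by simp
  qed
qed

lemma free_eval_closed:
  assumes "subspace W" and "\<And>g w. w \<in> W \<Longrightarrow> \<phi> g w \<in> W" and "w \<in> W"
  shows "free_eval \<phi> p w \<in> W"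
proof -
  have "foldr \<phi> gs w \<in> W" for gs
    by (induction gs) (use assms in auto)
  then show ?thesis
    unfolding free_eval_def by (intro subspace_sum subspace_scale assms(1))
qed

lemma submodule_of_presented_iff:
  assumes "module_structure smul (presented_algebra R) \<sigma>"
  shows "submodule_of smul (presented_algebra R) \<sigma> W \<longleftrightarrow>
    subspace W \<and> (\<forall>g. \<forall>w\<in>W. \<sigma> (rel_coset R (gen g)) w \<in> W)"
proof -
  have "\<sigma> (rel_coset R p) = free_eval (\<lambda>g. \<sigma> (rel_coset R (gen g))) p" for p
    using assms unfolding module_structure_presented_iff by blast
  then have "\<sigma> (rel_coset R p) w \<in> W"
    if "subspace W" "\<forall>g. \<forall>w\<in>W. \<sigma> (rel_coset R (gen g)) w \<in> W" "w \<in> W" for p w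
    using free_eval_closed[of W "\<lambda>g. \<sigma> (rel_coset R (gen g))"] that by metis
  then show ?thesis
    unfolding submodule_of_def presented_algebra_simps by blast
qed

end

section \<open>Stable subspaces and eigenvectors\<close>

context vspace
begin

lemma lin_funpow: "lin f \<Longrightarrow> lin (f ^^ n)"
  by (induction n) (auto intro!: linI simp: lin_add lin_scale)

lemma subspace_eigenspace: "lin T \<Longrightarrow> subspace {v. T v = \<theta> \<cdot> v}"
  by (auto simp: subspace_def lin_add lin_scale lin_zero scale_right_distrib mult.commute)

text \<open>Comparing the coefficients of \<open>T v\<close> and \<open>\<mu> \<cdot> v\<close> in
  \<open>B\<close> gives \<open>a b * (\<theta> b - \<mu>) = 0\<close> for every
  \<open>b\<close>.\<close>

lemma eigenvector_in_span:
  assumes T: "lin T" and B: "finite B" "independent B"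
    and eig: "\<And>b. b \<in> B \<Longrightarrow> T b = \<theta> b \<cdot> b"
    and v: "v \<in> span B" "T v = \<mu> \<cdot> v"
  shows "v \<in> span {b \<in> B. \<theta> b = \<mu>}"
proof -
  obtain a where a: "v = (\<Sum>b\<in>B. a b \<cdot> b)"
    using v(1) unfolding span_finite[OF B(1)] by blast
  have "T v = (\<Sum>b\<in>B. (a b * \<theta> b) \<cdot> b)"
    unfolding a lin_sum[OF T] by (intro sum.cong) (simp_all add: lin_scale[OF T] eig)
  moreover have "\<mu> \<cdot> v = (\<Sum>b\<in>B. (a b * \<mu>) \<cdot> b)"
    unfolding a scale_sum_right by (intro sum.cong) (simp_all add: mult.commute)
  ultimately have "(\<Sum>b\<in>B. (a b * (\<theta> b - \<mu>)) \<cdot> b) = 0"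
    using v(2) by (simp add: right_diff_distrib scale_left_diff_distrib sum_subtractf)
  then have zero: "a b = 0" if "b \<in> B" "\<theta> b \<noteq> \<mu>" for b
    using independentD[OF B(2) B(1) order_refl _ that(1), of "\<lambda>b. a b * (\<theta> b - \<mu>)"] that
    by simp
  have "v = (\<Sum>b\<in>{b \<in> B. \<theta> b = \<mu>}. a b \<cdot> b)"
    unfolding a by (rule sum.mono_neutral_right) (use B zero in auto)
  then show ?thesis
    by (auto intro!: span_sum span_scale intro: span_base)
qed

text \<open>A vector of \<open>T\<close> outside \<open>span S\<close> could be added to
  \<open>S\<close>, giving an independent set in \<open>span T\<close> larger than the spanning set
  \<open>T\<close>.\<close>

lemma spanning_of_card_eq:
  assumes T: "finite T" and S: "independent S" "S \<subseteq> span T" "card S = card T"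
  shows "span T \<subseteq> span S"
proof -
  have "t \<in> span S" if t: "t \<in> T" for t
  proof (rule ccontr)
    assume t': "t \<notin> span S"
    have "finite S"
      using independent_span_bound[OF T S(1,2)] by simp
    moreover have "t \<notin> S"
      using t' span_base by blast
    moreover have "card (insert t S) \<le> card T"
      using independent_span_bound[OF T independent_insertI[OF t' S(1)]] S(2) span_base[OF t]
      by simp
    ultimately show False
      using S(3) by simp
  qed
  then show ?thesis
    by (intro span_minimal subspace_span) auto
qed

text \<open>Subtracting \<theta>0 times the sum from its image under \<open>T\<close> removes one
  component and multiplies each other one by a nonzero scalar. The induction is over arbitrary
  \<open>f\<close> because it is applied to the rescaled components.\<close>

lemma eigencomponents_in_subspace:
  assumes T: "lin T" and U: "subspace U" "\<And>u. u \<in> U \<Longrightarrow> T u \<in> U"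
    and "finite \<Theta>" and "\<And>\<theta>. \<theta> \<in> \<Theta> \<Longrightarrow> T (f \<theta>) = \<theta> \<cdot> f \<theta>" and "(\<Sum>\<theta>\<in>\<Theta>. f \<theta>) \<in> U"
  shows "\<theta> \<in> \<Theta> \<Longrightarrow> f \<theta> \<in> U"
  using assms(4-)
proof (induction \<Theta> arbitrary: f \<theta> rule: finite_induct)
  case empty
  then show ?case by simp
next
  case (insert \<theta>\<^sub>0 \<Theta>)
  let ?v = "\<Sum>\<theta>\<in>insert \<theta>\<^sub>0 \<Theta>. f \<theta>"
  have "T ?v = (\<Sum>\<theta>\<in>insert \<theta>\<^sub>0 \<Theta>. \<theta> \<cdot> f \<theta>)"
    unfolding lin_sum[OF T] by (intro sum.cong insert.prems(2)) simp
  then have "T ?v - \<theta>\<^sub>0 \<cdot> ?v = (\<Sum>\<theta>\<in>insert \<theta>\<^sub>0 \<Theta>. (\<theta> - \<theta>\<^sub>0) \<cdot> f \<theta>)"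
    by (simp only: scale_sum_right scale_left_diff_distrib sum_subtractf)
  then have "(\<Sum>\<theta>\<in>\<Theta>. (\<theta> - \<theta>\<^sub>0) \<cdot> f \<theta>) = T ?v - \<theta>\<^sub>0 \<cdot> ?v"
    using insert.hyps by simp
  also have "\<dots> \<in> U"
    using insert.prems(3) U by (intro subspace_diff subspace_scale) auto
  finally have "(\<Sum>\<theta>\<in>\<Theta>. (\<theta> - \<theta>\<^sub>0) \<cdot> f \<theta>) \<in> U" .
  then have scaled: "(\<theta> - \<theta>\<^sub>0) \<cdot> f \<theta> \<in> U" if "\<theta> \<in> \<Theta>" for \<theta>
    using that insert.prems(2)
    by (intro insert.IH[of \<theta> "\<lambda>\<theta>. (\<theta> - \<theta>\<^sub>0) \<cdot> f \<theta>"]) (auto simp: lin_scale[OF T] mult.commute)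
  have rest: "f \<theta> \<in> U" if "\<theta> \<in> \<Theta>" for \<theta>
  proof -
    have "\<theta> - \<theta>\<^sub>0 \<noteq> 0"
      using that insert.hyps(2) by auto
    then have "f \<theta> = inverse (\<theta> - \<theta>\<^sub>0) \<cdot> ((\<theta> - \<theta>\<^sub>0) \<cdot> f \<theta>)"
      by simp
    also have "\<dots> \<in> U"
      by (intro subspace_scale U(1) scaled that)
    finally show ?thesis .
  qed
  have "?v - (\<Sum>\<theta>\<in>\<Theta>. f \<theta>) \<in> U"
    by (rule subspace_diff[OF U(1) insert.prems(3) subspace_sum[OF U(1) rest]])
  then have "f \<theta>\<^sub>0 \<in> U"
    using insert.hyps by simp
  then show ?case
    using rest insert.prems(1) by auto
qed

text \<open>An expansion into eigenvectors, grouped by eigenvalue, has one component per eigenvalue,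
  and a stable subspace contains these components along with the vector.\<close>

lemma stable_subspace_eigenspan:
  assumes T: "lin T" "span {v. \<exists>\<theta>. T v = \<theta> \<cdot> v} = UNIV"
    and U: "subspace U" "\<And>u. u \<in> U \<Longrightarrow> T u \<in> U"
  shows "U \<subseteq> span {u \<in> U. \<exists>\<theta>. T u = \<theta> \<cdot> u}"
proof
  fix v assume v: "v \<in> U"
  have "v \<in> span {v. \<exists>\<theta>. T v = \<theta> \<cdot> v}"
    using T(2) by simp
  then obtain S r where S: "finite S" "S \<subseteq> {v. \<exists>\<theta>. T v = \<theta> \<cdot> v}" and v_sum: "v = (\<Sum>a\<in>S. r a \<cdot> a)"
    unfolding span_explicit by blast
  have "\<forall>a\<in>S. \<exists>\<theta>. T a = \<theta> \<cdot> a"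
    using S(2) by blast
  then obtain \<theta> where \<theta>: "\<And>a. a \<in> S \<Longrightarrow> T a = \<theta> a \<cdot> a"
    unfolding bchoice_iff by blast
  define f where "f \<mu> = (\<Sum>a\<in>{a \<in> S. \<theta> a = \<mu>}. r a \<cdot> a)" for \<mu>
  have v_f: "v = (\<Sum>\<mu>\<in>\<theta> ` S. f \<mu>)"
    unfolding v_sum f_def by (rule sum.image_gen[OF S(1)])
  have eig: "T (f \<mu>) = \<mu> \<cdot> f \<mu>" for \<mu>
    unfolding f_def lin_sum[OF T(1)] scale_sum_right
    by (intro sum.cong) (auto simp: lin_scale[OF T(1)] \<theta> mult.commute)
  have "f \<mu> \<in> U" if "\<mu> \<in> \<theta> ` S" for \<mu>
    using eigencomponents_in_subspace[OF T(1) U finite_imageI[OF S(1)] eig v[unfolded v_f] that] .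
  then show "v \<in> span {u \<in> U. \<exists>\<theta>. T u = \<theta> \<cdot> u}"
    unfolding v_f using eig by (intro span_sum span_base) blast
qed

text \<open>One operator is added at a time. By commutativity, the part of \<open>U\<close> in a
  joint eigenspace of the earlier operators is stable under \<open>T j\<close>, so the case of a
  single operator applies there.\<close>

lemma stable_subspace_joint_eigenspan:
  assumes lin: "\<And>i. lin (T i)" and ss: "\<And>i. span {v. \<exists>\<theta>. T i v = \<theta> \<cdot> v} = UNIV"
    and comm: "\<And>i j v. T i (T j v) = T j (T i v)"
    and U: "subspace U" "\<And>i u. u \<in> U \<Longrightarrow> T i u \<in> U"
    and "finite I"
  shows "U \<subseteq> span {u \<in> U. \<forall>i\<in>I. \<exists>\<theta>. T i u = \<theta> \<cdot> u}"
  using \<open>finite I\<close>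
proof induction
  case empty
  then show ?case by (auto intro: span_base)
next
  case (insert j I)
  have "x \<in> span {u \<in> U. \<forall>i\<in>insert j I. \<exists>\<theta>. T i u = \<theta> \<cdot> u}"
    if x: "x \<in> U" "\<forall>i\<in>I. \<exists>\<theta>. T i x = \<theta> \<cdot> x" for x
  proof -
    obtain \<theta> where \<theta>: "\<And>i. i \<in> I \<Longrightarrow> T i x = \<theta> i \<cdot> x"
      using x(2) by metis
    let ?U = "U \<inter> (\<Inter>i\<in>I. {v. T i v = \<theta> i \<cdot> v})"
    have "subspace ?U"
      using U(1) by (intro subspace_Int subspace_inter subspace_eigenspace lin) auto
    moreover have "T j u \<in> ?U" if "u \<in> ?U" for u
      using that U(2) by (auto simp: comm[of _ j] lin_scale[OF lin])
    ultimately have "?U \<subseteq> span {u \<in> ?U. \<exists>\<theta>. T j u = \<theta> \<cdot> u}"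
      by (rule stable_subspace_eigenspan[OF lin ss])
    also have "\<dots> \<subseteq> span {u \<in> U. \<forall>i\<in>insert j I. \<exists>\<theta>. T i u = \<theta> \<cdot> u}"
      by (rule span_mono) auto
    finally show ?thesis
      using x(1) \<theta> by auto
  qed
  then have "span {u \<in> U. \<forall>i\<in>I. \<exists>\<theta>. T i u = \<theta> \<cdot> u}
      \<subseteq> span {u \<in> U. \<forall>i\<in>insert j I. \<exists>\<theta>. T i u = \<theta> \<cdot> u}"
    by (intro span_minimal subspace_span) auto
  with insert.IH show ?case by blast
qed

lemma lin_span_closed:
  assumes "lin T" and "\<And>x. x \<in> X \<Longrightarrow> T x \<in> span X" and "x \<in> span X"
  shows "T x \<in> span X"
proof -
  have "span X \<subseteq> T -` span X"
    using Vector_Spaces.linear.axioms(3)[OF assms(1)] assms(2)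
    by (intro span_minimal module_hom.subspace_vimage[of smul smul T]) auto
  then show ?thesis
    using assms(3) by blast
qed

text \<open>An eigenvalue that does not occur on a basis of eigenvectors would put its eigenvectors
  into the span of the empty set. This supplies the finiteness of weights on which the downward
  inductions below rest.\<close>

lemma finite_eigenvalues:
  assumes T: "lin T" "span {v. \<exists>\<theta>. T v = \<theta> \<cdot> v} = UNIV" and "finite S" "span S = UNIV"
  shows "finite {\<theta>. \<exists>v. v \<noteq> 0 \<and> T v = \<theta> \<cdot> v}"
proof -
  obtain B where B: "B \<subseteq> {v. \<exists>\<theta>. T v = \<theta> \<cdot> v}" "independent B"
    "{v. \<exists>\<theta>. T v = \<theta> \<cdot> v} \<subseteq> span B"
    using maximal_independent_subset by blast
  have fin: "finite B"
    using independent_span_bound[OF assms(3) B(2)] assms(4) by auto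
  have "span B = UNIV"
    using span_minimal[OF B(3) subspace_span] T(2) by blast
  have "\<forall>b\<in>B. \<exists>\<theta>. T b = \<theta> \<cdot> b"
    using B(1) by blast
  then obtain \<theta> where \<theta>: "\<And>b. b \<in> B \<Longrightarrow> T b = \<theta> b \<cdot> b"
    unfolding bchoice_iff by blast
  have "\<mu> \<in> \<theta> ` B" if "v \<noteq> 0" "T v = \<mu> \<cdot> v" for v \<mu>
  proof (rule ccontr)
    assume "\<mu> \<notin> \<theta> ` B"
    then have "{b \<in> B. \<theta> b = \<mu>} = {}"
      by blast
    moreover have "v \<in> span {b \<in> B. \<theta> b = \<mu>}"
      by (rule eigenvector_in_span[OF T(1) fin B(2) \<theta>]) (use \<open>span B = UNIV\<close> that in auto)
    ultimately have "v \<in> span {}"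
      by (simp only:)
    then show False
      using that(1) by simp
  qed
  then have "{\<theta>. \<exists>v. v \<noteq> 0 \<and> T v = \<theta> \<cdot> v} \<subseteq> \<theta> ` B"
    by blast
  then show ?thesis
    using fin finite_subset by blast
qed

end

section \<open>Weights of quantum \<open>sl\<^sub>2\<close> modules\<close>

lemma powi_inj:
  fixes q :: "'f::field"
  assumes q: "q \<noteq> 0" "\<And>k. k > 0 \<Longrightarrow> q ^ k \<noteq> 1"
  shows "q powi m = q powi n \<longleftrightarrow> m = n"
proof
  assume "q powi m = q powi n"
  then have one: "q powi (m - n) = 1"
    using q(1) by (simp add: power_int_diff)
  show "m = n"
  proof (rule ccontr)
    assume "m \<noteq> n"
    then have "q ^ nat \<bar>m - n\<bar> \<noteq> 1"
      by (intro q(2)) simp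
    then show False
      using one by (auto simp: power_int_def power_inverse split: if_splits)
  qed
qed simp

text \<open>The commutator of \<open>E\<close> and \<open>F\<close> is prescribed on weight vectors
  only, with the inverse of \<open>K\<close> already evaluated. This makes the assumptions symmetric
  under exchanging \<open>E\<close> and \<open>F\<close> and inverting \<open>q\<close>.\<close>

locale uq_sl2_module = vspace smul
  for smul :: "'f::field \<Rightarrow> 'v::ab_group_add \<Rightarrow> 'v" (infixr "\<cdot>" 75) +
  fixes q \<epsilon> :: 'f and E F K :: "'v \<Rightarrow> 'v"
  assumes lin_E: "lin E" and lin_F: "lin F" and lin_K: "lin K"
    and q_nonzero: "q \<noteq> 0" and q_not_root: "\<And>m. m > 0 \<Longrightarrow> q ^ m \<noteq> 1" and \<epsilon>_nonzero: "\<epsilon> \<noteq> 0"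
    and K_E: "\<And>v. K (E v) = q\<^sup>2 \<cdot> E (K v)"
    and K_F: "\<And>v. K (F v) = inverse (q\<^sup>2) \<cdot> F (K v)"
    and E_F: "\<And>m v. K v = (\<epsilon> * q powi m) \<cdot> v \<Longrightarrow>
      E (F v) - F (E v) = (\<epsilon> * ((q powi m - inverse (q powi m)) / (q - inverse q))) \<cdot> v"
    and finite_weights: "finite {m::int. \<exists>v. v \<noteq> 0 \<and> K v = (\<epsilon> * q powi m) \<cdot> v}"
begin

definition wt :: "int \<Rightarrow> 'v set" where
  "wt m = {v. K v = (\<epsilon> * q powi m) \<cdot> v}"

lemma subspace_wt: "subspace (wt m)"
  unfolding wt_def by (rule subspace_eigenspace[OF lin_K])

lemma q_powi_inj: "q powi m = q powi n \<longleftrightarrow> m = n"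
  using q_nonzero q_not_root by (rule powi_inj)

lemma q_minus_inverse_powi_eq_zero_iff: "q powi m - inverse (q powi m) = 0 \<longleftrightarrow> m = 0"
  using q_powi_inj[of m "- m"] by (simp add: power_int_minus)

lemma q_minus_inverse_nonzero: "q - inverse q \<noteq> 0"
  using q_minus_inverse_powi_eq_zero_iff[of 1] by simp

lemma E_wt: "v \<in> wt m \<Longrightarrow> E v \<in> wt (m + 2)"
  using q_nonzero
  by (simp add: wt_def K_E lin_scale[OF lin_E] power_int_add power2_eq_square mult_ac)

lemma F_wt: "v \<in> wt m \<Longrightarrow> F v \<in> wt (m - 2)"
  using q_nonzero
  by (simp add: wt_def K_F lin_scale[OF lin_F] power_int_diff power2_eq_square field_simps)

lemma E_pow_wt: "v \<in> wt m \<Longrightarrow> (E ^^ n) v \<in> wt (m + 2 * int n)"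
proof (induction n)
  case (Suc n)
  then have "E ((E ^^ n) v) \<in> wt (m + 2 * int n + 2)"
    by (intro E_wt) simp
  then show ?case by (simp add: add_ac)
qed simp

text \<open>\<open>\<epsilon> [n] [m + n - 1]\<close> in quantum integers\<close>

definition comm_coeff :: "int \<Rightarrow> nat \<Rightarrow> 'f" where
  "comm_coeff m n = \<epsilon> * ((q powi int n - inverse (q powi int n)) *
     (q powi (m + int n - 1) - inverse (q powi (m + int n - 1))) / (q - inverse q)\<^sup>2)"

lemma comm_coeff_Suc:
  "comm_coeff m (Suc n) = comm_coeff m n +
    \<epsilon> * ((q powi (m + 2 * int n) - inverse (q powi (m + 2 * int n))) / (q - inverse q))"
proof -
  define x y x' y' q' d where "x = q powi int n" and "y = q powi m" and "x' = inverse x"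
    and "y' = inverse y" and "q' = inverse q" and "d = q - q'"
  note defs = this
  have add: "q powi (a + b) = q powi a * q powi b" for a b
    using q_nonzero by (simp add: power_int_add)
  have diff: "q powi (a - 1) = q powi a * q'" for a
    using q_nonzero by (simp add: power_int_diff defs divide_inverse)
  have int_eqs: "int (Suc n) = int n + 1" "m + (int n + 1) - 1 = m + int n"
    "m + 2 * int n = m + int n + int n"
    by simp_all
  have powi: "q powi int (Suc n) = q * x" "q powi (m + int (Suc n) - 1) = y * x"
    "q powi int n = x" "q powi (m + int n - 1) = y * x * q'" "q powi (m + 2 * int n) = y * x * x"
    unfolding int_eqs add diff by (simp_all add: defs)
  have inverses: "inverse (q * x) = q' * x'" "inverse (y * x) = y' * x'" "inverse x = x'"
    "inverse (y * x * q') = q * y' * x'" "inverse (y * x * x) = y' * x' * x'"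
    by (simp_all add: defs)
  \<comment> \<open>This is \<open>[n + 1] [m + n] = [n] [m + n - 1] + [m + 2 n]\<close> in quantum
    integers, with denominators cleared. It holds for independent letters \<open>x\<close>,
    \<open>x'\<close>, \<open>y\<close>, \<open>y'\<close>, \<open>q\<close>, \<open>q'\<close>, so
    plain ring arithmetic suffices.\<close>
  have "(q * x - q' * x') * (y * x - y' * x')
      = (x - x') * (y * x * q' - q * y' * x') + (y * x * x - y' * x' * x') * d"
    by (simp add: d_def algebra_simps)
  moreover have "d \<noteq> 0"
    using q_minus_inverse_nonzero by (simp add: defs)
  ultimately have "(q * x - q' * x') * (y * x - y' * x') / d\<^sup>2
      = (x - x') * (y * x * q' - q * y' * x') / d\<^sup>2 + (y * x * x - y' * x' * x') / d"
    by (simp add: add_divide_distrib power2_eq_square)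
  then show ?thesis
    unfolding comm_coeff_def powi inverses unfolding q'_def[symmetric] d_def[symmetric]
    by (simp only: distrib_left)
qed

lemma comm_coeff_eq_zero_iff: "comm_coeff m n = 0 \<longleftrightarrow> n = 0 \<or> m + int n = 1"
proof -
  have "m + int n - 1 = 0 \<longleftrightarrow> m + int n = 1" by linarith
  then show ?thesis
    by (simp only: comm_coeff_def mult_eq_0_iff divide_eq_0_iff \<epsilon>_nonzero
        q_minus_inverse_powi_eq_zero_iff power_eq_0_iff q_minus_inverse_nonzero) simp
qed

lemma F_E_pow:
  assumes "v \<in> wt m"
  shows "F ((E ^^ n) v) = (E ^^ n) (F v) - comm_coeff m n \<cdot> (E ^^ (n - 1)) v"
proof (induction n)
  case 0
  show ?case by (simp add: comm_coeff_def)
next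
  case (Suc n)
  let ?c = "\<epsilon> * ((q powi (m + 2 * int n) - inverse (q powi (m + 2 * int n))) / (q - inverse q))"
  have "E (F ((E ^^ n) v)) - F (E ((E ^^ n) v)) = ?c \<cdot> (E ^^ n) v"
    using E_F E_pow_wt[OF assms, of n] by (simp add: wt_def)
  then have "F (E ((E ^^ n) v)) = E (F ((E ^^ n) v)) - ?c \<cdot> (E ^^ n) v"
    by (simp add: algebra_simps)
  \<comment> \<open>For \<open>n = 0\<close> the exponent \<open>n - 1\<close> is truncated, but
    then \<open>comm_coeff m n\<close> is zero.\<close>
  also have "E (F ((E ^^ n) v)) = (E ^^ Suc n) (F v) - comm_coeff m n \<cdot> (E ^^ n) v"
    unfolding Suc.IH by (cases n) (simp_all add: lin_diff[OF lin_E] lin_scale[OF lin_E] comm_coeff_def)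
  finally show ?case
    by (simp add: comm_coeff_Suc scale_left_distrib)
qed

text \<open>Applying \<open>F\<close> lowers the weight, which is bounded below, so inductively \<open>F v = 0\<close>; for a lowest
  weight vector the coefficients of \<open>F (E ^^ i) v\<close> do not vanish.\<close>

lemma E_pow_eq_zero_imp:
  assumes "v \<in> wt (- int m)" and "j \<le> m" and "(E ^^ j) v = 0"
  shows "v = 0"
proof -
  have "bdd_above ((\<lambda>k::int. - k) ` {m. \<exists>v. v \<noteq> 0 \<and> K v = (\<epsilon> * q powi m) \<cdot> v})"
    by (intro bdd_above_finite finite_imageI finite_weights)
  then obtain N :: int where N: "\<And>k v. v \<in> wt k \<Longrightarrow> v \<noteq> 0 \<Longrightarrow> - k \<le> N"
    unfolding bdd_above_def wt_def by auto
  from assms show ?thesis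
  \<comment> \<open>Since \<open>- N\<close> bounds the weights from below, the measure is positive
    as long as the weight \<open>- int m\<close> occurs, so it drops strictly when \<open>F\<close>
    replaces \<open>m\<close> by \<open>m + 2\<close>.\<close>
  proof (induction "nat (N + 1 - int m)" arbitrary: m v j rule: less_induct)
    case less
    show ?case
    proof (rule ccontr)
      assume v: "v \<noteq> 0"
      then have "int m \<le> N"
        using N[OF less.prems(1)] by simp
      moreover have "F v \<in> wt (- int (m + 2))"
      proof -
        have "- int (m + 2) = - int m - 2" by simp
        then show ?thesis using F_wt[OF less.prems(1)] by metis
      qed
      moreover have "(E ^^ Suc j) (F v) = 0"
        using F_E_pow[OF less.prems(1), of "Suc j"] less.prems(3)
        by (simp add: lin_zero[OF lin_E] lin_zero[OF lin_F])
      ultimately have F: "F v = 0"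
        using less.prems(2) by (intro less.hyps[of "m + 2" "F v" "Suc j"]) auto
      have "(E ^^ i) v \<noteq> 0" if "i \<le> j" for i
        using that
      proof (induction i)
        case (Suc i)
        show ?case
        proof
          assume "(E ^^ Suc i) v = 0"
          then have "comm_coeff (- int m) (Suc i) \<cdot> (E ^^ i) v = 0"
            using F_E_pow[OF less.prems(1), of "Suc i"] F
            by (simp add: lin_zero[OF lin_F] lin_zero[OF lin_E] lin_zero[OF lin_funpow[OF lin_E]])
          then show False
            using Suc less.prems(2) by (auto simp: comm_coeff_eq_zero_iff)
        qed
      qed (simp add: v)
      then show False
        using less.prems(3) by blast
    qed
  qed
qed

text \<open>Modulo \<open>E W\<close>, every \<open>w \<in> W\<close> of weight \<open>- m \<le> 0\<close> can be chosen to be killed by \<open>E ^^ Suc m\<close>, and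
  such vectors are killed by \<open>F\<close>.\<close>

lemma F_stable:
  assumes W: "subspace W" "\<And>w. w \<in> W \<Longrightarrow> E w \<in> W"
    and surj: "\<And>m w. w \<in> W \<inter> wt (int m) \<Longrightarrow> \<exists>w'\<in>W \<inter> wt (- int m). w = (E ^^ m) w'"
    and w: "w \<in> W \<inter> wt k"
  shows "F w \<in> W"
proof -
  have E_pow: "(E ^^ n) w \<in> W" if "w \<in> W" for n w
    using that W(2) by (induction n) auto
  have "bdd_above ((\<lambda>k::int. - k) ` {m. \<exists>v. v \<noteq> 0 \<and> K v = (\<epsilon> * q powi m) \<cdot> v})"
    by (intro bdd_above_finite finite_imageI finite_weights)
  then obtain N :: int where N: "\<And>k v. v \<in> wt k \<Longrightarrow> v \<noteq> 0 \<Longrightarrow> - k \<le> N"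
    unfolding bdd_above_def wt_def by auto
  have neg: "F w \<in> W" if "w \<in> W \<inter> wt (- int m)" for w m
    using that
  proof (induction "nat (N + 1 - int m)" arbitrary: m w rule: less_induct)
    case less
    show ?case
    proof (cases "w = 0")
      case True
      then show ?thesis using less.prems by (simp add: lin_zero[OF lin_F])
    next
      case False
      then have m: "int m \<le> N"
        using N[of w "- int m"] less.prems by simp
      \<comment> \<open>The exponent \<open>Suc m\<close> is chosen to reach the weight opposite to
        that of \<open>F w\<close>. There \<open>surj\<close> yields \<open>u\<close> of weight
        \<open>- int (m + 2)\<close>, so \<open>E u\<close> has the weight of \<open>w\<close> and
        can serve as a correction.\<close>
      have "(E ^^ Suc m) w \<in> W \<inter> wt (int (m + 2))"
      proof -
        have "- int m + 2 * int (Suc m) = int (m + 2)" by simp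
        then show ?thesis
          using E_pow[of w "Suc m"] E_pow_wt[of w "- int m" "Suc m"] less.prems
          by (simp only: Int_iff)
      qed
      then obtain u where u: "u \<in> W" "u \<in> wt (- int (m + 2))" "(E ^^ Suc m) w = (E ^^ (m + 2)) u"
        using surj[of "(E ^^ Suc m) w" "m + 2"] by blast
      have "F u \<in> W"
        using u m by (intro less.hyps[of "m + 2"]) auto
      have minus_m: "- int (m + 2) = - int m - 2" "- int m - 2 + 2 = - int m"
        by simp_all
      have wEu: "w - E u \<in> wt (- int m)"
        using less.prems E_wt[OF u(2)] unfolding minus_m by (intro subspace_diff subspace_wt) auto
      define x where "x = w - E u"
      have "(E ^^ (m + 2)) u = (E ^^ Suc m) (E u)"
        by (simp only: add_2_eq_Suc' funpow_Suc_right comp_apply)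
      then have "(E ^^ Suc m) x = 0"
        unfolding x_def lin_diff[OF lin_funpow[OF lin_E]] u(3) by (simp only: diff_self)
      moreover have "m + 2 - 1 = Suc m" "m + 2 = Suc (Suc m)"
        by simp_all
      ultimately have "(E ^^ (m + 2 - 1)) x = 0" "(E ^^ (m + 2)) x = 0"
        by (simp_all only: funpow.simps(2) comp_apply lin_zero[OF lin_E])
      \<comment> \<open>Both other terms of the commutation formula contain a power of
        \<open>E\<close> that kills \<open>x\<close>; injectivity of \<open>E ^^ (m + 2)\<close> on
        the weight of \<open>F x\<close> then gives \<open>F x = 0\<close>.\<close>
      then have "(E ^^ (m + 2)) (F x) = 0"
        using F_E_pow[OF wEu[folded x_def], of "m + 2"]
        by (simp only: lin_zero[OF lin_F] scale_zero_right diff_0_right)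
      moreover have "F x \<in> wt (- int (m + 2))"
        using F_wt[OF wEu[folded x_def]] by (simp only: minus_m)
      ultimately have "F (w - E u) = 0"
        unfolding x_def[symmetric] by (rule E_pow_eq_zero_imp[OF _ order_refl, rotated])
      \<comment> \<open>It remains to commute \<open>F\<close> past a single \<open>E\<close>: this
        leaves \<open>F u\<close>, which is in \<open>W\<close> by induction because
        \<open>u\<close> has lower weight than \<open>w\<close>, and a multiple of
        \<open>u\<close>.\<close>
      then have "F w = F (E u)"
        by (simp add: lin_diff[OF lin_F])
      also have "\<dots> = E (F u) - comm_coeff (- int (m + 2)) 1 \<cdot> u"
        using F_E_pow[OF u(2), of 1] by simp
      also have "\<dots> \<in> W"
        by (rule subspace_diff[OF W(1) W(2)[OF \<open>F u \<in> W\<close>] subspace_scale[OF W(1) u(1)]])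
      finally show ?thesis .
    qed
  qed
  show ?thesis
  proof (cases "k \<le> 0")
    case True
    then show ?thesis using neg[of w "nat (- k)"] w by simp
  next
    case False
    \<comment> \<open>A positive weight needs no induction: by \<open>surj\<close> the vector is a
      power of \<open>E\<close> applied to a vector of opposite weight in \<open>W\<close>, which
      \<open>neg\<close> covers.\<close>
    define m where "m = nat k"
    then have "k = int m"
      using False by simp
    then obtain u where u: "u \<in> W" "u \<in> wt (- int m)" "w = (E ^^ m) u"
      using surj[of w m] w by blast
    have "F w = (E ^^ m) (F u) - comm_coeff (- int m) m \<cdot> (E ^^ (m - 1)) u"
      unfolding u(3) by (rule F_E_pow[OF u(2)])
    also have "\<dots> \<in> W"
      using u(1,2) by (intro subspace_diff[OF W(1)] subspace_scale[OF W(1)] E_pow neg[of _ m]) auto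
    finally show ?thesis .
  qed
qed

lemma inj_on_E_pow: "inj_on (E ^^ m) (wt (- int m))"
proof -
  interpret Em: Vector_Spaces.linear smul smul "E ^^ m"
    by (rule lin_funpow[OF lin_E])
  show ?thesis
    using Em.inj_on_iff_eq_0[OF subspace_wt] E_pow_eq_zero_imp[of _ m m] by blast
qed

section \<open>Subspaces with a basis of weight vectors, stable under \<open>E\<close>\<close>

context
  fixes B :: "'v set" and w :: "'v \<Rightarrow> int"
  assumes finite_B: "finite B" and indep_B: "independent B"
    and wt_B: "\<And>b. b \<in> B \<Longrightarrow> b \<in> wt (w b)"
    and E_B: "\<And>v. v \<in> span B \<Longrightarrow> E v \<in> span B"
begin

lemma wt_in_span:
  assumes "v \<in> span B" "v \<in> wt m"
  shows "v \<in> span {b \<in> B. w b = m}"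
proof -
  have "v \<in> span {b \<in> B. \<epsilon> * q powi w b = \<epsilon> * q powi m}"
    by (rule eigenvector_in_span[OF lin_K finite_B indep_B _ assms(1)])
      (use wt_B assms(2) in \<open>auto simp: wt_def\<close>)
  then show ?thesis
    using \<epsilon>_nonzero by (simp add: q_powi_inj)
qed

lemma span_wt_subset: "span {b \<in> B. w b = m} \<subseteq> span B \<inter> wt m"
  using wt_B by (intro Int_greatest span_mono span_minimal subspace_wt) auto

lemma E_pow_wt_basis:
  "independent ((E ^^ m) ` {b \<in> B. w b = - int m})"
  "card ((E ^^ m) ` {b \<in> B. w b = - int m}) = card {b \<in> B. w b = - int m}"
  "(E ^^ m) ` {b \<in> B. w b = - int m} \<subseteq> span {b \<in> B. w b = int m}"
proof -
  interpret Em: Vector_Spaces.linear smul smul "E ^^ m"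
    by (rule lin_funpow[OF lin_E])
  let ?B = "{b \<in> B. w b = - int m}"
  have inj: "inj_on (E ^^ m) (span ?B)"
    using inj_on_E_pow span_wt_subset by (blast intro: inj_on_subset)
  show "independent ((E ^^ m) ` ?B)"
    by (rule Em.independent_injective_image[OF independent_mono[OF indep_B] inj]) auto
  show "card ((E ^^ m) ` ?B) = card ?B"
    by (rule card_image[OF inj_on_subset[OF inj]]) (rule span_superset)
  have "(E ^^ n) b \<in> span B" if "b \<in> span B" for b n
    using that E_B by (induction n) auto
  moreover have "(E ^^ m) b \<in> wt (int m)" if "b \<in> ?B" for b
    using E_pow_wt[of b "w b" m] wt_B[of b] that by simp
  ultimately show "(E ^^ m) ` ?B \<subseteq> span {b \<in> B. w b = int m}"
    using wt_in_span span_base by blast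
qed

lemma card_wt_le: "card {b \<in> B. w b = - int m} \<le> card {b \<in> B. w b = int m}"
  using independent_span_bound[OF _ E_pow_wt_basis(1) E_pow_wt_basis(3)] E_pow_wt_basis(2) finite_B
  by simp

text \<open>Grouping by absolute value leaves exactly the differences whose sign
  \<open>card_wt_le\<close> controls; weight zero contributes nothing, so the sum may start at
  1.\<close>

lemma sum_weights:
  assumes "\<And>b. b \<in> B \<Longrightarrow> \<bar>w b\<bar> \<le> int N"
  shows "(\<Sum>b\<in>B. w b) = (\<Sum>m = 1..N. int m *
    (int (card {b \<in> B. w b = int m}) - int (card {b \<in> B. w b = - int m})))"
proof -
  have card: "(\<Sum>b\<in>B. of_bool (P b)) = int (card {b \<in> B. P b})" for P
    using finite_B by (simp add: of_bool_def sum.If_cases Int_def)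
  have "w b = (\<Sum>m = 1..N. int m * (of_bool (w b = int m) - of_bool (w b = - int m)))"
    if b: "b \<in> B" for b
  proof -
    have "(\<Sum>m = 1..N. int m * (of_bool (w b = int m) - of_bool (w b = - int m)))
        = (\<Sum>m = 1..N. if m = nat \<bar>w b\<bar> then w b else 0)"
      by (intro sum.cong) (auto simp: of_bool_def)
    also have "\<dots> = w b"
      using assms[OF b] by (auto simp: sum.delta)
    finally show ?thesis by simp
  qed
  then have "(\<Sum>b\<in>B. w b)
      = (\<Sum>b\<in>B. \<Sum>m = 1..N. int m * (of_bool (w b = int m) - of_bool (w b = - int m)))"
    by (rule sum.cong[OF refl])
  also have "\<dots> = (\<Sum>m = 1..N. int m *
      ((\<Sum>b\<in>B. of_bool (w b = int m)) - (\<Sum>b\<in>B. of_bool (w b = - int m))))"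
    by (subst sum.swap) (simp only: sum_distrib_left[symmetric] sum_subtractf)
  finally show ?thesis
    unfolding card .
qed

lemma weights_bounded:
  obtains N where "\<And>b. b \<in> B \<Longrightarrow> \<bar>w b\<bar> \<le> int N"
proof
  show "\<bar>w b\<bar> \<le> int (\<Sum>b\<in>B. nat \<bar>w b\<bar>)" if "b \<in> B" for b
  proof -
    have "nat \<bar>w b\<bar> \<le> (\<Sum>b\<in>B. nat \<bar>w b\<bar>)"
      by (rule member_le_sum[OF that _ finite_B]) simp
    then show ?thesis by linarith
  qed
qed

lemma sum_weights_nonneg: "(\<Sum>b\<in>B. w b) \<ge> 0"
proof -
  obtain N where N: "\<And>b. b \<in> B \<Longrightarrow> \<bar>w b\<bar> \<le> int N"
    using weights_bounded by blast
  have "(\<Sum>b\<in>B. w b) = (\<Sum>m = 1..N. int m *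
      (int (card {b \<in> B. w b = int m}) - int (card {b \<in> B. w b = - int m})))"
    by (rule sum_weights) (rule N)
  also have "\<dots> \<ge> 0"
    by (intro sum_nonneg mult_nonneg_nonneg) (use card_wt_le in auto)
  finally show ?thesis .
qed

text \<open>When nonnegative terms sum to zero, the weights \<open>m\<close> and \<open>- m\<close>
  have equally many basis vectors. The independent images under \<open>E ^^ m\<close> are then
  numerous enough to span the part of weight \<open>m\<close>.\<close>

lemma E_pow_surj:
  assumes "(\<Sum>b\<in>B. w b) = 0" and v: "v \<in> span B \<inter> wt (int m)"
  shows "\<exists>v'\<in>span B \<inter> wt (- int m). v = (E ^^ m) v'"
proof -
  obtain N where N: "\<And>b. b \<in> B \<Longrightarrow> \<bar>w b\<bar> \<le> int N"
    using weights_bounded by blast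
  have "(\<Sum>m = 1..N. int m *
      (int (card {b \<in> B. w b = int m}) - int (card {b \<in> B. w b = - int m}))) = (\<Sum>b\<in>B. w b)"
    by (rule sum_weights[symmetric]) (rule N)
  also have "\<dots> = 0"
    by (rule assms(1))
  finally have "\<forall>m\<in>{1..N}. int m *
      (int (card {b \<in> B. w b = int m}) - int (card {b \<in> B. w b = - int m})) = 0"
    by (subst (asm) sum_nonneg_eq_0_iff) (use card_wt_le in auto)
  then have "card {b \<in> B. w b = int m} = card {b \<in> B. w b = - int m}" if "m \<in> {1..N}"
    using that by fastforce
  \<comment> \<open>For \<open>m = 0\<close> the two sets are literally the same, and for
    \<open>m > N\<close> both are empty.\<close>
  moreover have "{b \<in> B. w b = int m} = {b \<in> B. w b = - int m}" if "m \<notin> {1..N}"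
    using N that by (cases "m = 0") force+
  ultimately have card: "card {b \<in> B. w b = int m} = card {b \<in> B. w b = - int m}"
    by (cases "m \<in> {1..N}") auto
  interpret Em: Vector_Spaces.linear smul smul "E ^^ m"
    by (rule lin_funpow[OF lin_E])
  have "v \<in> span {b \<in> B. w b = int m}"
    using wt_in_span v by blast
  also have "\<dots> \<subseteq> span ((E ^^ m) ` {b \<in> B. w b = - int m})"
    by (rule spanning_of_card_eq[OF _ E_pow_wt_basis(1) E_pow_wt_basis(3)])
      (use finite_B card E_pow_wt_basis(2) in auto)
  also have "\<dots> = (E ^^ m) ` span {b \<in> B. w b = - int m}"
    by (rule Em.span_image)
  finally show ?thesis
    using span_wt_subset[of "- int m"] by blast
qed

lemma F_stable_span:
  assumes "(\<Sum>b\<in>B. w b) = 0" and "v \<in> span B"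
  shows "F v \<in> span B"
proof -
  have "F b \<in> span B" if "b \<in> B" for b
    by (rule F_stable[OF subspace_span E_B E_pow_surj[OF assms(1)], of _ "w b"])
      (use that wt_B span_base in auto)
  then show ?thesis
    using lin_span_closed[OF lin_F _ assms(2)] by blast
qed

end

text \<open>Exchanging \<open>E\<close> and \<open>F\<close> while inverting \<open>q\<close> (and keeping \<open>K\<close>) preserves all relations; the weight
  \<open>m\<close> becomes \<open>- m\<close>.\<close>

lemma swap_E_F: "uq_sl2_module smul (inverse q) \<epsilon> F E K"
proof -
  have neg: "inverse q powi m = q powi (- m)" for m
    by (simp add: power_int_inverse power_int_minus)
  have "{m. \<exists>v. v \<noteq> 0 \<and> K v = (\<epsilon> * inverse q powi m) \<cdot> v}
      = uminus ` {m. \<exists>v. v \<noteq> 0 \<and> K v = (\<epsilon> * q powi m) \<cdot> v}"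
    unfolding neg by (auto simp: image_iff) (metis minus_minus)+
  then have fin: "finite {m. \<exists>v. v \<noteq> 0 \<and> K v = (\<epsilon> * inverse q powi m) \<cdot> v}"
    using finite_weights by simp
  show ?thesis
  proof unfold_locales
    show "inverse q ^ m \<noteq> 1" if "m > 0" for m
      using q_not_root[OF that] by (simp add: power_inverse)
    fix m v
    assume "K v = (\<epsilon> * inverse q powi m) \<cdot> v"
    then have "K v = (\<epsilon> * q powi (- m)) \<cdot> v"
      by (simp add: neg)
    from E_F[OF this]
    have EF: "E (F v) - F (E v) =
        (\<epsilon> * ((q powi (- m) - q powi m) / (q - inverse q))) \<cdot> v"
      by (simp add: power_int_minus)
    have "F (E v) - E (F v) = - (E (F v) - F (E v))"
      by simp
    also have "\<dots> = (- (\<epsilon> * ((q powi (- m) - q powi m) / (q - inverse q)))) \<cdot> v"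
      by (simp only: EF scale_minus_left)
    also have "- (\<epsilon> * ((q powi (- m) - q powi m) / (q - inverse q)))
        = \<epsilon> * ((q powi (- m) - q powi m) / (inverse q - q))"
      using minus_divide_right[of "\<epsilon> * (q powi (- m) - q powi m)" "q - inverse q"]
      by simp
    finally show "F (E v) - E (F v) = (\<epsilon> * ((inverse q powi m - inverse (inverse q powi m))
        / (inverse q - inverse (inverse q)))) \<cdot> v"
      by (simp add: neg power_int_minus)
  qed (use fin q_nonzero \<epsilon>_nonzero lin_E lin_F lin_K K_E K_F in \<open>auto simp: power_inverse lin_add lin_scale\<close>)
qed

lemma swap_wt: "uq_sl2_module.wt smul (inverse q) \<epsilon> K m = wt (- m)"
proof -
  interpret sw: uq_sl2_module smul "inverse q" \<epsilon> F E K
    by (rule swap_E_F)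
  show ?thesis
    by (simp add: sw.wt_def wt_def power_int_inverse power_int_minus)
qed

text \<open>The exchanged structure assigns to \<open>b\<close> the weight \<open>- w b\<close>, so
  the nonnegativity lemma applies to both signs of the sum.\<close>

lemma sum_weights_eq_zero:
  assumes "finite B" "independent B" "\<And>b. b \<in> B \<Longrightarrow> b \<in> wt (w b)"
    and "\<And>v. v \<in> span B \<Longrightarrow> E v \<in> span B" "\<And>v. v \<in> span B \<Longrightarrow> F v \<in> span B"
  shows "(\<Sum>b\<in>B. w b) = 0"
proof -
  interpret sw: uq_sl2_module smul "inverse q" \<epsilon> F E K
    by (rule swap_E_F)
  have "(\<Sum>b\<in>B. - w b) \<ge> 0"
    using assms by (intro sw.sum_weights_nonneg) (auto simp: swap_wt)
  moreover have "(\<Sum>b\<in>B. w b) \<ge> 0"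
    using assms by (intro sum_weights_nonneg) auto
  ultimately show ?thesis
    by (simp add: sum_negf)
qed

text \<open>The opposite weight is reached by an injective power of \<open>E\<close> from
  nonpositive weights, and by one of \<open>F\<close>, through the exchange, from positive
  ones.\<close>

lemma wt_symmetric:
  assumes "v \<in> wt m" "v \<noteq> 0"
  shows "\<exists>v'\<in>wt (- m). v' \<noteq> 0"
proof (cases "m \<le> 0")
  case True
  then show ?thesis
    using E_pow_eq_zero_imp[of v "nat (- m)" "nat (- m)"] E_pow_wt[of v m "nat (- m)"] assms
    by (intro bexI[of _ "(E ^^ nat (- m)) v"]) auto
next
  case False
  interpret sw: uq_sl2_module smul "inverse q" \<epsilon> F E K
    by (rule swap_E_F)
  show ?thesis
    using sw.E_pow_eq_zero_imp[of v "nat m" "nat m"] sw.E_pow_wt[of v "- m" "nat m"] assms False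
    by (intro bexI[of _ "(F ^^ nat m) v"]) (auto simp: swap_wt)
qed

end

section \<open>Modules of affine type\<close>

locale affine_uq_module = vspace smul
  for smul :: "'f::field \<Rightarrow> 'v::ab_group_add \<Rightarrow> 'v" (infixr "\<cdot>" 75) +
  fixes A :: "int ^ 'n::finite ^ 'n" and s :: "'n \<Rightarrow> nat" and q :: 'f
    and \<epsilon> :: "'n \<Rightarrow> 'f" and E F K K' :: "'n \<Rightarrow> 'v \<Rightarrow> 'v" and u :: "'n \<Rightarrow> real"
  assumes A_diag: "\<And>i. A $ i $ i = 2"
    and s_pos: "\<And>i. s i > 0"
    and A_sym: "\<And>i j. int (s i) * A $ i $ j = int (s j) * A $ j $ i"
    and u_pos: "\<And>i. u i > 0"
    and A_u: "\<And>i. (\<Sum>j\<in>UNIV. real_of_int (A $ i $ j) * u j) = 0"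
    and q_nonzero: "q \<noteq> 0" and q_not_root: "\<And>m. m > 0 \<Longrightarrow> q ^ m \<noteq> 1"
    and \<epsilon>_sign: "\<And>i. \<epsilon> i \<in> {1, -1}"
    and lin_E: "\<And>i. lin (E i)" and lin_F: "\<And>i. lin (F i)"
    and lin_K: "\<And>i. lin (K i)" and lin_K': "\<And>i. lin (K' i)"
    and K'_K: "\<And>i v. K' i (K i v) = v"
    and K_K: "\<And>i j v. K i (K j v) = K j (K i v)"
    and K_E: "\<And>i j v. K i (E j v) = ((q ^ s i) powi (A $ i $ j)) \<cdot> E j (K i v)"
    and K_F: "\<And>i j v. K i (F j v) = ((q ^ s i) powi (- (A $ i $ j))) \<cdot> F j (K i v)"
    and E_F: "\<And>i v. E i (F i v) - F i (E i v) =
      (1 / (q ^ s i - inverse (q ^ s i))) \<cdot> (K i v - K' i v)"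
    and K_semisimple: "\<And>i. span {v. \<exists>\<theta>. K i v = \<theta> \<cdot> v} = UNIV"
    and K_eigenvalue: "\<And>i v \<theta>. v \<noteq> 0 \<Longrightarrow> K i v = \<theta> \<cdot> v \<Longrightarrow> \<exists>m. \<theta> = \<epsilon> i * (q ^ s i) powi m"
    and finite_dim: "\<exists>S. finite S \<and> span S = UNIV"
    and irreducible: "\<And>W. subspace W \<Longrightarrow>
      (\<And>i w. w \<in> W \<Longrightarrow> E i w \<in> W \<and> F i w \<in> W \<and> K i w \<in> W \<and> K' i w \<in> W) \<Longrightarrow>
      W = {0} \<or> W = UNIV"
begin

lemma \<epsilon>_nonzero: "\<epsilon> i \<noteq> 0"
  using \<epsilon>_sign[of i] by auto

lemma qs_nonzero: "q ^ s i \<noteq> 0"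
  using q_nonzero by simp

lemma qs_not_root: "m > 0 \<Longrightarrow> (q ^ s i) ^ m \<noteq> 1"
  using q_not_root[of "s i * m"] s_pos[of i] by (simp add: power_mult)

lemma K'_eigenvector:
  assumes "K i v = \<theta> \<cdot> v"
  shows "K' i v = inverse \<theta> \<cdot> v"
proof (cases "v = 0")
  case True
  then show ?thesis by (simp add: lin_zero[OF lin_K'])
next
  case False
  have v: "\<theta> \<cdot> K' i v = v"
    using K'_K[of i v] unfolding assms lin_scale[OF lin_K'] .
  have "\<theta> \<noteq> 0"
  proof
    assume "\<theta> = 0"
    then show False
      using v False by simp
  qed
  then have "K' i v = inverse \<theta> \<cdot> (\<theta> \<cdot> K' i v)"
    by simp
  then show ?thesis
    unfolding v .
qed

lemma sl2: "uq_sl2_module smul (q ^ s i) (\<epsilon> i) (E i) (F i) (K i)"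
proof -
  obtain S where S: "finite S" "span S = UNIV"
    using finite_dim by blast
  have "finite ((\<lambda>m. \<epsilon> i * (q ^ s i) powi m) ` {m. \<exists>v. v \<noteq> 0 \<and> K i v = (\<epsilon> i * (q ^ s i) powi m) \<cdot> v})"
    by (rule finite_subset[OF _ finite_eigenvalues[OF lin_K K_semisimple S]]) auto
  moreover have "inj (\<lambda>m. \<epsilon> i * (q ^ s i) powi m)"
    using powi_inj[OF qs_nonzero qs_not_root] \<epsilon>_nonzero by (auto intro!: injI)
  ultimately have fin: "finite {m. \<exists>v. v \<noteq> 0 \<and> K i v = (\<epsilon> i * (q ^ s i) powi m) \<cdot> v}"
    using finite_imageD inj_on_subset by blast
  have EF: "E i (F i v) - F i (E i v) = (\<epsilon> i * (((q ^ s i) powi m - inverse ((q ^ s i) powi m))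
      / (q ^ s i - inverse (q ^ s i)))) \<cdot> v"
    if v: "K i v = (\<epsilon> i * (q ^ s i) powi m) \<cdot> v" for m v
  proof -
    \<comment> \<open>The inverse of \<open>K i\<close> acts by
      \<open>inverse (\<epsilon> i)\<close> times a power of \<open>q ^ s i\<close>; because the
      sign is its own inverse, it factors out of \<open>K i v - K' i v\<close> as the rank one
      setting demands.\<close>
    have "inverse (\<epsilon> i) = \<epsilon> i"
      using \<epsilon>_sign[of i] by auto
    then have "K i v - K' i v = (\<epsilon> i * ((q ^ s i) powi m - inverse ((q ^ s i) powi m))) \<cdot> v"
      using v K'_eigenvector[OF v]
      by (simp add: right_diff_distrib scale_left_diff_distrib)
    then show ?thesis
      by (simp add: E_F)
  qed
  show ?thesis
  proof unfold_locales
    show "K i (E i v) = (q ^ s i)\<^sup>2 \<cdot> E i (K i v)" for v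
      using K_E[of i i v] by (simp add: A_diag)
    show "K i (F i v) = inverse ((q ^ s i)\<^sup>2) \<cdot> F i (K i v)" for v
      using K_F[of i i v] by (simp add: A_diag power_int_minus)
  qed (use fin EF qs_nonzero qs_not_root \<epsilon>_nonzero in
      \<open>auto simp: lin_add lin_scale lin_E lin_F lin_K\<close>)
qed

lemma finite_independent:
  assumes "independent B"
  shows "finite B"
proof -
  obtain S where "finite S" "span S = UNIV"
    using finite_dim by blast
  then show ?thesis
    using independent_span_bound[of S B] assms by simp
qed

definition joint_wt :: "('n \<Rightarrow> int) \<Rightarrow> 'v set" where
  "joint_wt \<mu> = {v. \<forall>i. K i v = (\<epsilon> i * (q ^ s i) powi \<mu> i) \<cdot> v}"

lemma joint_wt_subset: "v \<in> joint_wt \<mu> \<Longrightarrow>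
    v \<in> uq_sl2_module.wt smul (q ^ s i) (\<epsilon> i) (K i) (\<mu> i)"
  by (simp add: uq_sl2_module.wt_def[OF sl2] joint_wt_def)

lemma E_joint_wt:
  assumes "v \<in> joint_wt \<mu>"
  shows "E j v \<in> joint_wt (\<lambda>i. \<mu> i + A $ i $ j)"
proof -
  have "K i (E j v) = (\<epsilon> i * (q ^ s i) powi (\<mu> i + A $ i $ j)) \<cdot> E j v" for i
  proof -
    have "K i (E j v) = ((q ^ s i) powi (A $ i $ j) * (\<epsilon> i * (q ^ s i) powi \<mu> i)) \<cdot> E j v"
      using assms by (simp add: joint_wt_def K_E lin_scale[OF lin_E])
    also have "(q ^ s i) powi (A $ i $ j) * (\<epsilon> i * (q ^ s i) powi \<mu> i)
        = \<epsilon> i * (q ^ s i) powi (\<mu> i + A $ i $ j)"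
      using power_int_add[of "q ^ s i" "\<mu> i" "A $ i $ j"] qs_nonzero[of i] by simp
    finally show ?thesis .
  qed
  then show ?thesis
    by (simp add: joint_wt_def)
qed

lemma F_joint_wt:
  assumes "v \<in> joint_wt \<mu>"
  shows "F j v \<in> joint_wt (\<lambda>i. \<mu> i - A $ i $ j)"
proof -
  have "K i (F j v) = (\<epsilon> i * (q ^ s i) powi (\<mu> i - A $ i $ j)) \<cdot> F j v" for i
  proof -
    have "K i (F j v) = ((q ^ s i) powi (- (A $ i $ j)) * (\<epsilon> i * (q ^ s i) powi \<mu> i)) \<cdot> F j v"
      using assms by (simp add: joint_wt_def K_F lin_scale[OF lin_F])
    also have "(q ^ s i) powi (- (A $ i $ j)) * (\<epsilon> i * (q ^ s i) powi \<mu> i)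
        = \<epsilon> i * (q ^ s i) powi (\<mu> i + - (A $ i $ j))"
      using power_int_add[of "q ^ s i" "\<mu> i" "- (A $ i $ j)"] qs_nonzero[of i] by simp
    finally show ?thesis
      by simp
  qed
  then show ?thesis
    by (simp add: joint_wt_def)
qed

text \<open>The central element of the affine algebra acts on \<open>joint_wt \<mu>\<close> by \<open>q\<close> to the power \<open>level \<mu>\<close>, up to
  sign and up to scaling the real null vector \<open>u\<close> of \<open>A\<close> to an integral one.\<close>

definition level :: "('n \<Rightarrow> int) \<Rightarrow> real" where
  "level \<mu> = (\<Sum>i\<in>UNIV. u i * real (s i) * real_of_int (\<mu> i))"

text \<open>The symmetrizer is what lets the null vector act from the left: it turns the sum over
  column \<open>j\<close> into \<open>s j\<close> times entry \<open>j\<close> of \<open>A\<close>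
  applied to \<open>u\<close>. Hence \<open>E j\<close> and \<open>F j\<close> preserve the
  level.\<close>

lemma level_column: "level (\<lambda>i. A $ i $ j) = 0"
proof -
  have "u i * real (s i) * real_of_int (A $ i $ j)
      = real (s j) * (real_of_int (A $ j $ i) * u i)" for i
  proof -
    have "real (s i) * real_of_int (A $ i $ j) = real_of_int (int (s i) * A $ i $ j)"
      by simp
    also have "\<dots> = real_of_int (int (s j) * A $ j $ i)"
      by (rule arg_cong[OF A_sym])
    also have "\<dots> = real (s j) * real_of_int (A $ j $ i)"
      by simp
    finally show ?thesis
      by (simp add: mult_ac)
  qed
  then show ?thesis
    by (simp only: level_def sum_distrib_left[symmetric] A_u mult_zero_right)
qed

lemma level_add: "level (\<lambda>i. \<mu> i + \<nu> i) = level \<mu> + level \<nu>"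
  by (simp add: level_def distrib_left sum.distrib)

lemma level_diff: "level (\<lambda>i. \<mu> i - \<nu> i) = level \<mu> - level \<nu>"
  by (simp add: level_def right_diff_distrib sum_subtractf)

lemma sum_level:
  "(\<Sum>b\<in>B. level (\<nu> b)) = (\<Sum>i\<in>UNIV. u i * real (s i) * real_of_int (\<Sum>b\<in>B. \<nu> b i))"
  unfolding level_def by (subst sum.swap) (simp add: sum_distrib_left)

text \<open>The weights of each \<open>K i\<close> on the whole module sum to zero, hence so do the levels; but by
  irreducibility all levels agree.\<close>

lemma level_eq_zero:
  assumes v: "v \<in> joint_wt \<mu>" "v \<noteq> 0"
  shows "level \<mu> = 0"
proof -
  \<comment> \<open>The span of all weight spaces on this level is a submodule, because
    \<open>E\<close> and \<open>F\<close> shift weights by columns of \<open>A\<close>; containing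
    \<open>v\<close>, it must be everything.\<close>
  let ?X = "\<Union>\<nu>\<in>{\<nu>. level \<nu> = level \<mu>}. joint_wt \<nu>"
  have X_closed: "E i x \<in> span ?X \<and> F i x \<in> span ?X \<and> K i x \<in> span ?X \<and> K' i x \<in> span ?X"
    if x: "x \<in> ?X" for i x
  proof -
    obtain \<nu> where \<nu>: "level \<nu> = level \<mu>" "x \<in> joint_wt \<nu>"
      using x by blast
    have "level (\<lambda>k. \<nu> k + A $ k $ i) = level \<mu>" "level (\<lambda>k. \<nu> k - A $ k $ i) = level \<mu>"
      using \<nu>(1) level_add[of \<nu> "\<lambda>k. A $ k $ i"] level_diff[of \<nu> "\<lambda>k. A $ k $ i"]
        level_column[of i]
      by linarith+
    then have EF: "E i x \<in> ?X" "F i x \<in> ?X"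
      using E_joint_wt[OF \<nu>(2), of i] F_joint_wt[OF \<nu>(2), of i] by blast+
    have K: "K i x = (\<epsilon> i * (q ^ s i) powi \<nu> i) \<cdot> x"
      using \<nu>(2) by (simp add: joint_wt_def)
    show ?thesis
      unfolding K K'_eigenvector[OF K]
      by (intro conjI span_scale span_base EF x)
  qed
  have "span ?X = {0} \<or> span ?X = UNIV"
  proof (rule irreducible[OF subspace_span], intro conjI)
    fix i w assume w: "w \<in> span ?X"
    show "E i w \<in> span ?X"
      by (rule lin_span_closed[OF lin_E _ w]) (use X_closed in blast)
    show "F i w \<in> span ?X"
      by (rule lin_span_closed[OF lin_F _ w]) (use X_closed in blast)
    show "K i w \<in> span ?X"
      by (rule lin_span_closed[OF lin_K _ w]) (use X_closed in blast)
    show "K' i w \<in> span ?X"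
      by (rule lin_span_closed[OF lin_K' _ w]) (use X_closed in blast)
  qed
  moreover have "v \<in> span ?X"
    using v(1) by (intro span_base) blast
  ultimately have X: "span ?X = UNIV"
    using v(2) by blast
  obtain B where B: "B \<subseteq> ?X" "independent B" "?X \<subseteq> span B"
    using maximal_independent_subset by blast
  have B_span: "span B = UNIV"
    using span_minimal[OF B(3) subspace_span] X by blast
  have fin: "finite B"
    by (rule finite_independent[OF B(2)])
  have "\<forall>b\<in>B. \<exists>\<nu>. level \<nu> = level \<mu> \<and> b \<in> joint_wt \<nu>"
    using B(1) by blast
  then obtain \<nu> where \<nu>: "\<And>b. b \<in> B \<Longrightarrow> level (\<nu> b) = level \<mu>" "\<And>b. b \<in> B \<Longrightarrow> b \<in> joint_wt (\<nu> b)"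
    unfolding bchoice_iff by blast
  have "(\<Sum>b\<in>B. \<nu> b i) = 0" for i
  proof -
    interpret sl2: uq_sl2_module smul "q ^ s i" "\<epsilon> i" "E i" "F i" "K i"
      by (rule sl2)
    show ?thesis
      by (rule sl2.sum_weights_eq_zero[OF fin B(2)])
        (simp_all add: joint_wt_subset[OF \<nu>(2)] B_span)
  qed
  then have "(\<Sum>b\<in>B. level (\<nu> b)) = 0"
    by (simp add: sum_level)
  then have "real (card B) * level \<mu> = 0"
    using \<nu>(1) by simp
  moreover have "B \<noteq> {}"
    using B_span v(2) by auto
  ultimately show ?thesis
    using fin by simp
qed

theorem nonneg_part_irreducible:
  assumes W: "subspace W" "\<And>i w. w \<in> W \<Longrightarrow> E i w \<in> W" "\<And>i w. w \<in> W \<Longrightarrow> K i w \<in> W"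
    "\<And>i w. w \<in> W \<Longrightarrow> K' i w \<in> W"
  shows "W = {0} \<or> W = UNIV"
proof (rule irreducible[OF W(1)])
  \<comment> \<open>The commuting diagonalizable operators \<open>K i\<close> preserve
    \<open>W\<close>, so a single basis of \<open>W\<close> consists of weight vectors for all
    \<open>i\<close> at once. The inequalities for different \<open>i\<close> can only be combined
    on such a common basis.\<close>
  let ?X = "{w \<in> W. \<forall>i\<in>UNIV. \<exists>\<theta>. K i w = \<theta> \<cdot> w}"
  have W_X: "W \<subseteq> span ?X"
    by (rule stable_subspace_joint_eigenspan[OF lin_K K_semisimple K_K W(1) W(3)]) simp_all
  obtain B where B: "B \<subseteq> ?X" "independent B" "?X \<subseteq> span B"
    using maximal_independent_subset by blast
  have B_span: "span B = W"
  proof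
    show "span B \<subseteq> W"
      using B(1) by (intro span_minimal W(1)) auto
    show "W \<subseteq> span B"
      using W_X span_minimal[OF B(3) subspace_span] by blast
  qed
  have fin: "finite B"
    by (rule finite_independent[OF B(2)])
  have "\<forall>b\<in>B. \<exists>\<nu>. b \<in> joint_wt \<nu>"
  proof
    fix b assume b: "b \<in> B"
    then have "b \<noteq> 0"
      using B(2) dependent_zero by blast
    have "\<exists>m. K i b = (\<epsilon> i * (q ^ s i) powi m) \<cdot> b" for i
    proof -
      obtain \<theta> where "K i b = \<theta> \<cdot> b"
        using B(1) b by blast
      then show ?thesis
        using K_eigenvalue[OF \<open>b \<noteq> 0\<close>] by metis
    qed
    then show "\<exists>\<nu>. b \<in> joint_wt \<nu>"
      unfolding joint_wt_def mem_Collect_eq by (rule choice[OF allI])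
  qed
  then obtain \<nu> where \<nu>: "\<And>b. b \<in> B \<Longrightarrow> b \<in> joint_wt (\<nu> b)"
    unfolding bchoice_iff by blast
  have wt: "b \<in> uq_sl2_module.wt smul (q ^ s i) (\<epsilon> i) (K i) (\<nu> b i)" if "b \<in> B" for b i
    using joint_wt_subset[OF \<nu>[OF that]] .
  have E_B: "E i v \<in> span B" if "v \<in> span B" for i v
    using that unfolding B_span by (rule W(2))
  have nonneg: "(\<Sum>b\<in>B. \<nu> b i) \<ge> 0" for i
    using uq_sl2_module.sum_weights_nonneg[OF sl2 fin B(2), where w = "\<lambda>b. \<nu> b i"] wt E_B
    by blast
  \<comment> \<open>Here information about the whole module enters: \<open>level_eq_zero\<close>
    holds for every nonzero joint weight vector, hence also for those spanning merely
    \<open>W\<close>.\<close>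
  have "level (\<nu> b) = 0" if "b \<in> B" for b
    using level_eq_zero[OF \<nu>[OF that]] B(2) that dependent_zero by blast
  then have "(\<Sum>i\<in>UNIV. u i * real (s i) * real_of_int (\<Sum>b\<in>B. \<nu> b i)) = 0"
    unfolding sum_level[symmetric] by simp
  moreover have "u i * real (s i) * real_of_int (\<Sum>b\<in>B. \<nu> b i) \<ge> 0" for i
    using nonneg[of i] u_pos[of i] by (intro mult_nonneg_nonneg) (simp_all del: of_int_sum)
  \<comment> \<open>A combination of nonnegative sums vanishes; since all its coefficients
    \<open>u i * s i\<close> are strictly positive, no single sum can be positive.\<close>
  ultimately have "\<forall>i\<in>UNIV. u i * real (s i) * real_of_int (\<Sum>b\<in>B. \<nu> b i) = 0"
    by (subst (asm) sum_nonneg_eq_0_iff) (simp_all del: of_int_sum)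
  then have zero: "(\<Sum>b\<in>B. \<nu> b i) = 0" for i
    using u_pos[of i] s_pos[of i] by (metis UNIV_I less_irrefl mult_eq_0_iff of_int_eq_0_iff of_nat_eq_0_iff)
  have "F i w \<in> W" if "w \<in> W" for i w
    using uq_sl2_module.F_stable_span[OF sl2 fin B(2), where w = "\<lambda>b. \<nu> b i" and v = w]
      wt E_B zero that B_span by blast
  then show "E i w \<in> W \<and> F i w \<in> W \<and> K i w \<in> W \<and> K' i w \<in> W" if "w \<in> W" for i w
    using W that by blast
qed

lemma eigenvalue_symmetric:
  assumes "v \<noteq> 0" "K i v = (\<epsilon> i * (q ^ s i) powi m) \<cdot> v"
  shows "\<exists>v'. v' \<noteq> 0 \<and> K i v' = (\<epsilon> i * (q ^ s i) powi (- m)) \<cdot> v'"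
  using uq_sl2_module.wt_symmetric[OF sl2, of v i m] assms
  by (auto simp: uq_sl2_module.wt_def[OF sl2])

end

section \<open>The rescaled action\<close>

lemma Uq_relationsI:
  fixes A :: "int ^ 'n::finite ^ 'n"
  shows "gen (UK i) * gen (UKinv i) - 1 \<in> Uq_relations A s q"
    and "gen (UKinv i) * gen (UK i) - 1 \<in> Uq_relations A s q"
    and "gen (UK i) * gen (UK j) - gen (UK j) * gen (UK i) \<in> Uq_relations A s q"
    and "gen (UK i) * gen (UE j) * gen (UKinv i) -
      scal ((q ^ s i) powi (A $ i $ j)) * gen (UE j) \<in> Uq_relations A s q"
    and "gen (UK i) * gen (UF j) * gen (UKinv i) -
      scal ((q ^ s i) powi (- (A $ i $ j))) * gen (UF j) \<in> Uq_relations A s q"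
    and "gen (UE i) * gen (UF j) - gen (UF j) * gen (UE i) -
      (if i = j then scal (1 / (q ^ s i - inverse (q ^ s i))) * (gen (UK i) - gen (UKinv i)) else 0)
      \<in> Uq_relations A s q"
    and "i \<noteq> j \<Longrightarrow> qserre (q ^ s i) (A $ i $ j) (gen (UE i)) (gen (UE j)) \<in> Uq_relations A s q"
  unfolding Uq_relations_def
  by ((rule UnI2, rule CollectI, (rule exI)+, rule conjI, rule refl, (rule TrueI | assumption))
      | rule UnI1 | (rule CollectI, (rule exI)+, rule conjI, rule refl, rule TrueI))+

context vspace
begin

lemma Uq_module_relations:
  assumes "module_structure smul (Uq A s q) \<rho>"
  defines "\<phi> \<equiv> \<lambda>g. \<rho> (Uq_gen A s q g)"
  shows "lin (\<phi> g)"
    and "\<phi> (UK i) (\<phi> (UKinv i) v) = v"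
    and "\<phi> (UKinv i) (\<phi> (UK i) v) = v"
    and "\<phi> (UK i) (\<phi> (UK j) v) = \<phi> (UK j) (\<phi> (UK i) v)"
    and "\<phi> (UK i) (\<phi> (UE j) v) = ((q ^ s i) powi (A $ i $ j)) \<cdot> \<phi> (UE j) (\<phi> (UK i) v)"
    and "\<phi> (UK i) (\<phi> (UF j) v) = ((q ^ s i) powi (- (A $ i $ j))) \<cdot> \<phi> (UF j) (\<phi> (UK i) v)"
    and "\<phi> (UE i) (\<phi> (UF i) v) - \<phi> (UF i) (\<phi> (UE i) v) =
      (1 / (q ^ s i - inverse (q ^ s i))) \<cdot> (\<phi> (UK i) v - \<phi> (UKinv i) v)"
    and "i \<noteq> j \<Longrightarrow> (\<Sum>r = 0..nat (1 - A $ i $ j).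
      ((-1) ^ r * qbinom (q ^ s i) (nat (1 - A $ i $ j)) r) \<cdot>
      (\<phi> (UE i) ^^ (nat (1 - A $ i $ j) - r)) (\<phi> (UE j) ((\<phi> (UE i) ^^ r) v))) = 0"
proof -
  let ?R = "Uq_relations A s q"
  have mod: "module_structure smul (presented_algebra ?R) \<rho>"
    using assms(1) by (simp only: Uq_def)
  have \<phi>: "\<phi> = (\<lambda>g. \<rho> (rel_coset ?R (gen g)))"
    by (simp add: \<phi>_def Uq_gen_def)
  have lin: "lin (\<phi> g)" for g
    unfolding \<phi> using mod unfolding module_structure_presented_iff by blast
  then show "lin (\<phi> g)" .
  have rel: "free_eval \<phi> r v = 0" if "r \<in> ?R" for r v
    unfolding \<phi> by (rule presented_module_relation[OF mod that])
  note eval = free_eval_diff free_eval_mult[OF lin] free_eval_gen free_eval_scal free_eval_one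
  from rel[OF Uq_relationsI(1), of i v] show "\<phi> (UK i) (\<phi> (UKinv i) v) = v"
    by (simp add: eval)
  from rel[OF Uq_relationsI(2)] have K'_K: "\<phi> (UKinv i) (\<phi> (UK i) v) = v" for i v
    by (simp add: eval)
  then show "\<phi> (UKinv i) (\<phi> (UK i) v) = v" .
  from rel[OF Uq_relationsI(3), of i j v] show "\<phi> (UK i) (\<phi> (UK j) v) = \<phi> (UK j) (\<phi> (UK i) v)"
    by (simp add: eval)
  \<comment> \<open>Evaluating at \<open>\<phi> (UK i) v\<close> cancels the trailing inverse in the
    relation.\<close>
  from rel[OF Uq_relationsI(4), of i j "\<phi> (UK i) v"]
  show "\<phi> (UK i) (\<phi> (UE j) v) = ((q ^ s i) powi (A $ i $ j)) \<cdot> \<phi> (UE j) (\<phi> (UK i) v)"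
    by (simp add: eval K'_K)
  from rel[OF Uq_relationsI(5), of i j "\<phi> (UK i) v"]
  show "\<phi> (UK i) (\<phi> (UF j) v) = ((q ^ s i) powi (- (A $ i $ j))) \<cdot> \<phi> (UF j) (\<phi> (UK i) v)"
    by (simp add: eval K'_K)
  from rel[OF Uq_relationsI(6), of i i v]
  show "\<phi> (UE i) (\<phi> (UF i) v) - \<phi> (UF i) (\<phi> (UE i) v) =
      (1 / (q ^ s i - inverse (q ^ s i))) \<cdot> (\<phi> (UK i) v - \<phi> (UKinv i) v)"
    by (simp add: eval)
  assume "i \<noteq> j"
  from rel[OF Uq_relationsI(7)[OF \<open>i \<noteq> j\<close>], of v]
  show "(\<Sum>r = 0..nat (1 - A $ i $ j).
      ((-1) ^ r * qbinom (q ^ s i) (nat (1 - A $ i $ j)) r) \<cdot>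
      (\<phi> (UE i) ^^ (nat (1 - A $ i $ j) - r)) (\<phi> (UE j) ((\<phi> (UE i) ^^ r) v))) = 0"
    by (simp only: free_eval_qserre[OF lin])
qed

lemma funpow_scaled:
  assumes "lin f"
  shows "((\<lambda>v. c \<cdot> f v) ^^ n) v = c ^ n \<cdot> (f ^^ n) v"
  by (induction n) (simp_all add: lin_scale[OF assms])

definition scaled_action ::
  "('n \<Rightarrow> 'f) \<Rightarrow> ('n \<Rightarrow> 'f) \<Rightarrow> ('n uq_gen \<Rightarrow> 'v \<Rightarrow> 'v) \<Rightarrow> 'n ugeq0_gen \<Rightarrow> 'v \<Rightarrow> 'v" where
  "scaled_action \<epsilon> \<alpha> \<phi> g = (case g of
     Ue i \<Rightarrow> (\<lambda>v. (\<epsilon> i * \<alpha> i) \<cdot> \<phi> (UE i) v)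
   | Uk i \<Rightarrow> (\<lambda>v. (\<epsilon> i * \<alpha> i) \<cdot> \<phi> (UK i) v)
   | Ukinv i \<Rightarrow> (\<lambda>v. (\<epsilon> i * inverse (\<alpha> i)) \<cdot> \<phi> (UKinv i) v))"

lemma scaled_action_simps [simp]:
  "scaled_action \<epsilon> \<alpha> \<phi> (Ue i) = (\<lambda>v. (\<epsilon> i * \<alpha> i) \<cdot> \<phi> (UE i) v)"
  "scaled_action \<epsilon> \<alpha> \<phi> (Uk i) = (\<lambda>v. (\<epsilon> i * \<alpha> i) \<cdot> \<phi> (UK i) v)"
  "scaled_action \<epsilon> \<alpha> \<phi> (Ukinv i) = (\<lambda>v. (\<epsilon> i * inverse (\<alpha> i)) \<cdot> \<phi> (UKinv i) v)"
  by (simp_all add: scaled_action_def)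

text \<open>Because each sign squares to 1, the scalars
  \<open>\<epsilon> i * inverse (\<alpha> i)\<close> and \<open>\<epsilon> i * \<alpha> i\<close>
  are inverse to each other. Compatibility can thus be solved for the action of the generators,
  which settles uniqueness and leaves only the relations for existence.\<close>

lemma compatible_iff:
  assumes \<epsilon>: "\<And>i. \<epsilon> i \<in> {1, -1}" and \<alpha>: "\<And>i. \<alpha> i \<noteq> 0"
  shows "compatible smul A s q \<epsilon> \<alpha> \<rho> \<sigma> \<longleftrightarrow>
    (\<forall>g. \<sigma> (Ugeq0_gen A s q g) = scaled_action \<epsilon> \<alpha> (\<lambda>g. \<rho> (Uq_gen A s q g)) g)"
proof -
  have diff_scale: "x - c \<cdot> y = 0 \<longleftrightarrow> y = c' \<cdot> x" if "c * c' = 1" for c c' x y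
  proof
    assume "x - c \<cdot> y = 0"
    then have "x = c \<cdot> y" by simp
    then show "y = c' \<cdot> x"
      using that by (simp add: mult.commute)
  next
    assume "y = c' \<cdot> x"
    then show "x - c \<cdot> y = 0"
      using that by simp
  qed
  have inv: "\<epsilon> i * inverse (\<alpha> i) * (\<epsilon> i * \<alpha> i) = 1" for i
    using \<epsilon>[of i] \<alpha>[of i] by auto
  have inv': "\<epsilon> i * \<alpha> i * (\<epsilon> i * inverse (\<alpha> i)) = 1" for i
    using inv[of i] by (simp only: mult.commute)
  have all_gens: "(\<forall>g. P g) \<longleftrightarrow> (\<forall>i. P (Ue i) \<and> P (Uk i) \<and> P (Ukinv i))"
    for P :: "'c ugeq0_gen \<Rightarrow> bool"
    by (metis ugeq0_gen.exhaust)
  show ?thesis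
    unfolding compatible_def diff_scale[OF inv] diff_scale[OF inv'] all_gens scaled_action_simps
      fun_eq_iff by blast
qed

text \<open>The scalars of a generator and of its inverse cancel, and the remaining relations are
  homogeneous, so a common scalar splits off. The inhomogeneous relation between \<open>E i\<close>
  and \<open>F i\<close> has no counterpart here.\<close>

lemma Ugeq0_relations_scaled_action:
  fixes A :: "int ^ 'n::finite ^ 'n"
  assumes mod: "module_structure smul (Uq A s q) \<rho>"
    and \<epsilon>: "\<And>i. \<epsilon> i \<in> {1, -1}" and \<alpha>: "\<And>i. \<alpha> i \<noteq> 0"
  defines "\<psi> \<equiv> scaled_action \<epsilon> \<alpha> (\<lambda>g. \<rho> (Uq_gen A s q g))"
  shows "lin (\<psi> g)" and "r \<in> Ugeq0_relations A s q \<Longrightarrow> free_eval \<psi> r v = 0"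
proof -
  define \<phi> where "\<phi> = (\<lambda>g. \<rho> (Uq_gen A s q g))"
  note Uq = Uq_module_relations[OF mod, folded \<phi>_def]
  have Uq_app: "\<And>g. \<rho> (Uq_gen A s q g) = \<phi> g"
    by (simp add: \<phi>_def)
  note Uq = Uq[unfolded Uq_app]
  have \<psi>: "\<psi> = scaled_action \<epsilon> \<alpha> \<phi>"
    by (simp add: \<psi>_def \<phi>_def)
  have lin: "lin (\<psi> g)" for g
    unfolding \<psi>
    by (cases g) (auto intro!: linI simp: lin_add[OF Uq(1)] lin_scale[OF Uq(1)]
        scale_right_distrib mult.commute)
  then show "lin (\<psi> g)" .
  note eval = free_eval_diff free_eval_mult[OF lin] free_eval_gen free_eval_scal free_eval_one
  have inv: "\<epsilon> i * \<alpha> i * (\<epsilon> i * inverse (\<alpha> i)) = 1" for i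
    using \<epsilon>[of i] \<alpha>[of i] by auto
  have inv': "\<epsilon> i * inverse (\<alpha> i) * (\<epsilon> i * \<alpha> i) = 1" for i
    using inv[of i] by (simp only: mult.commute)
  have kk': "\<psi> (Uk i) (\<psi> (Ukinv i) v) = v" for i v
    by (simp only: \<psi> scaled_action_simps lin_scale[OF Uq(1)] Uq(2) scale_scale inv scale_one)
  have k'k: "\<psi> (Ukinv i) (\<psi> (Uk i) v) = v" for i v
    by (simp only: \<psi> scaled_action_simps lin_scale[OF Uq(1)] Uq(3) scale_scale inv' scale_one)
  have kk: "\<psi> (Uk i) (\<psi> (Uk j) v) = \<psi> (Uk j) (\<psi> (Uk i) v)" for i j v
    unfolding \<psi> scaled_action_simps lin_scale[OF Uq(1)] Uq(4)[of i j v] scale_scale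
    by (simp only: mult.commute)
  have "\<psi> (Uk i) (\<psi> (Ue j) v) = ((q ^ s i) powi (A $ i $ j)) \<cdot> \<psi> (Ue j) (\<psi> (Uk i) v)" for i j v
    unfolding \<psi> scaled_action_simps lin_scale[OF Uq(1)] Uq(5)[of i j v] scale_scale
    by (simp only: mult_ac)
  from this[of _ _ "\<psi> (Ukinv _) _"]
  have kek': "\<psi> (Uk i) (\<psi> (Ue j) (\<psi> (Ukinv i) v)) = ((q ^ s i) powi (A $ i $ j)) \<cdot> \<psi> (Ue j) v"
    for i j v
    by (simp only: kk')
  have serre: "free_eval \<psi> (qserre (q ^ s i) (A $ i $ j) (gen (Ue i)) (gen (Ue j))) v = 0"
    if "i \<noteq> j" for i j v
  proof -
    let ?m = "nat (1 - A $ i $ j)"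
    let ?c = "\<lambda>r. (-1) ^ r * qbinom (q ^ s i) ?m r"
    let ?a = "\<epsilon> i * \<alpha> i" and ?b = "\<epsilon> j * \<alpha> j"
    have "free_eval \<psi> (qserre (q ^ s i) (A $ i $ j) (gen (Ue i)) (gen (Ue j))) v =
      (\<Sum>r = 0..?m. ?c r \<cdot> (\<psi> (Ue i) ^^ (?m - r)) (\<psi> (Ue j) ((\<psi> (Ue i) ^^ r) v)))"
      by (rule free_eval_qserre[OF lin])
    \<comment> \<open>Every summand contains the first generator \<open>?m\<close> times and the
      second one once, so the scalar does not depend on \<open>r\<close>.\<close>
    also have "\<dots> = (\<Sum>r = 0..?m. (?a ^ ?m * ?b) \<cdot>
      (?c r \<cdot> (\<phi> (UE i) ^^ (?m - r)) (\<phi> (UE j) ((\<phi> (UE i) ^^ r) v))))"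
    proof (rule sum.cong[OF refl])
      fix r assume "r \<in> {0..?m}"
      then have pow: "?a ^ ?m = ?a ^ (?m - r) * ?a ^ r"
        by (simp flip: power_add)
      have coeff: "?c r * (?a ^ (?m - r) * (?b * ?a ^ r)) = ?a ^ ?m * ?b * ?c r"
        unfolding pow by (simp only: mult_ac)
      show "?c r \<cdot> (\<psi> (Ue i) ^^ (?m - r)) (\<psi> (Ue j) ((\<psi> (Ue i) ^^ r) v)) = (?a ^ ?m * ?b) \<cdot>
          (?c r \<cdot> (\<phi> (UE i) ^^ (?m - r)) (\<phi> (UE j) ((\<phi> (UE i) ^^ r) v)))"
        unfolding \<psi> scaled_action_simps funpow_scaled[OF Uq(1)] lin_scale[OF Uq(1)]
          lin_scale[OF lin_funpow[OF Uq(1)]] scale_scale coeff ..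
    qed
    also have "\<dots> = 0"
      unfolding scale_sum_right[symmetric] Uq(8)[OF that] by simp
    finally show ?thesis .
  qed
  assume "r \<in> Ugeq0_relations A s q"
  then show "free_eval \<psi> r v = 0"
    unfolding Ugeq0_relations_def
    by (elim UnE CollectE exE conjE) (simp_all only: eval kk' k'k kk kek' serre diff_self simp_thms)
qed

end

lemma affine_uq_module_of_module:
  fixes A :: "int ^ 'n::finite ^ 'n" and smul :: "'f::field \<Rightarrow> 'v::ab_group_add \<Rightarrow> 'v"
  assumes "affine_type A" and "symmetrizer A s" and "q \<noteq> 0" and "\<forall>m>0. q ^ m \<noteq> 1"
    and "vector_space smul" and fd: "finite_dim smul"
    and mod: "module_structure smul (Uq A s q) \<rho>"
    and irr: "irreducible_module smul (Uq A s q) \<rho>"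
    and type: "Uq_type smul A s q \<rho> \<epsilon>"
  obtains u where "affine_uq_module smul A s q \<epsilon> (\<lambda>i. \<rho> (Uq_gen A s q (UE i)))
    (\<lambda>i. \<rho> (Uq_gen A s q (UF i))) (\<lambda>i. \<rho> (Uq_gen A s q (UK i)))
    (\<lambda>i. \<rho> (Uq_gen A s q (UKinv i))) u"
proof -
  interpret vspace smul
    using assms(5) by (rule vspace.intro)
  write smul (infixr "\<cdot>" 75)
  obtain u :: "real ^ 'n" where u: "\<And>i. u $ i > 0" "map_matrix real_of_int A *v u = 0"
    using assms(1) unfolding affine_type_def by blast
  have "(\<Sum>j\<in>UNIV. real_of_int (A $ i $ j) * u $ j) = (map_matrix real_of_int A *v u) $ i" for i
    by (simp add: matrix_vector_mult_def map_matrix_def)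
  then have Au: "(\<Sum>j\<in>UNIV. real_of_int (A $ i $ j) * u $ j) = 0" for i
    by (simp add: u(2))
  note Uq = Uq_module_relations[OF mod]
  have sub: "submodule_of smul (Uq A s q) \<rho> W \<longleftrightarrow>
      subspace W \<and> (\<forall>g. \<forall>w\<in>W. \<rho> (Uq_gen A s q g) w \<in> W)" for W
    using submodule_of_presented_iff[OF mod[unfolded Uq_def]] by (simp add: Uq_def Uq_gen_def)
  have "affine_uq_module smul A s q \<epsilon> (\<lambda>i. \<rho> (Uq_gen A s q (UE i)))
    (\<lambda>i. \<rho> (Uq_gen A s q (UF i))) (\<lambda>i. \<rho> (Uq_gen A s q (UK i)))
    (\<lambda>i. \<rho> (Uq_gen A s q (UKinv i))) (\<lambda>i. u $ i)"
  proof (intro affine_uq_module.intro vspace_axioms affine_uq_module_axioms.intro)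
    fix i j
    show "A $ i $ i = 2"
      using assms(1) by (simp add: affine_type_def gen_cartan_matrix_def)
    show "s i > 0" "int (s i) * A $ i $ j = int (s j) * A $ j $ i"
      using assms(2) by (simp_all add: symmetrizer_def)
    show "\<epsilon> i \<in> {1, -1}"
      using type by (simp add: Uq_type_def)
    show "span {v. \<exists>\<theta>. \<rho> (Uq_gen A s q (UK i)) v = \<theta> \<cdot> v} = UNIV"
      using type by (simp add: Uq_type_def acts_semisimply_def)
  next
    fix i v \<theta>
    assume "v \<noteq> 0" "\<rho> (Uq_gen A s q (UK i)) v = smul \<theta> v"
    then have "\<theta> \<in> eigenvalues smul (\<rho> (Uq_gen A s q (UK i)))"
      unfolding eigenvalues_def by blast
    moreover have "eigenvalues smul (\<rho> (Uq_gen A s q (UK i)))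
        \<subseteq> {\<epsilon> i * (q ^ s i) powi m | m. True}"
      using type by (simp add: Uq_type_def)
    ultimately show "\<exists>m. \<theta> = \<epsilon> i * (q ^ s i) powi m"
      by blast
  next
    show "\<exists>S. finite S \<and> span S = UNIV"
      using fd by (simp add: finite_dim_def)
  next
    fix W
    assume W: "subspace W" "\<And>i w. w \<in> W \<Longrightarrow> \<rho> (Uq_gen A s q (UE i)) w \<in> W \<and>
      \<rho> (Uq_gen A s q (UF i)) w \<in> W \<and> \<rho> (Uq_gen A s q (UK i)) w \<in> W \<and>
      \<rho> (Uq_gen A s q (UKinv i)) w \<in> W"
    have "\<rho> (Uq_gen A s q g) w \<in> W" if "w \<in> W" for g w
      using W(2)[OF that] by (cases g) simp_all
    then have "submodule_of smul (Uq A s q) \<rho> W"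
      using W(1) sub by blast
    then show "W = {0} \<or> W = UNIV"
      using irr by (simp add: irreducible_module_def)
  qed (use u(1) Au assms(3,4) Uq(1,3-7) in simp_all)
  then show thesis
    by (rule that)
qed

theorem theorem2p5:
  fixes A :: "int ^ 'n::finite ^ 'n"
    and s :: "'n \<Rightarrow> nat"
    and q :: "'f::{alg_closed_field, field_char_0}"
    and smul :: "'f \<Rightarrow> 'v::ab_group_add \<Rightarrow> 'v"
    and \<rho> :: "('n uq_gen word \<Rightarrow>\<^sub>0 'f) set \<Rightarrow> 'v \<Rightarrow> 'v"
    and \<epsilon> \<alpha> :: "'n \<Rightarrow> 'f"
  assumes "affine_type A"
    and "symmetrizer A s"
    and "q \<noteq> 0"
    and "\<forall>m>0. q ^ m \<noteq> 1"
    and "vector_space smul"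
    and "finite_dim smul"
    and "module_structure smul (Uq A s q) \<rho>"
    and "irreducible_module smul (Uq A s q) \<rho>"
    and "Uq_type smul A s q \<rho> \<epsilon>"
    and "\<forall>i. \<alpha> i \<noteq> 0"
  shows "(\<exists>!\<sigma>. module_structure smul (Ugeq0 A s q) \<sigma> \<and> compatible smul A s q \<epsilon> \<alpha> \<rho> \<sigma>) \<and>
         (\<forall>\<sigma>. module_structure smul (Ugeq0 A s q) \<sigma> \<and> compatible smul A s q \<epsilon> \<alpha> \<rho> \<sigma> \<longrightarrow>
            irreducible_module smul (Ugeq0 A s q) \<sigma> \<and> Ugeq0_type smul A s q \<sigma> \<alpha>)"
proof -
  write smul (infixr "\<cdot>" 75)
  let ?E = "\<lambda>i. \<rho> (Uq_gen A s q (UE i))" and ?F = "\<lambda>i. \<rho> (Uq_gen A s q (UF i))"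
    and ?K = "\<lambda>i. \<rho> (Uq_gen A s q (UK i))" and ?K' = "\<lambda>i. \<rho> (Uq_gen A s q (UKinv i))"
  let ?R = "Ugeq0_relations A s q"
  obtain u where "affine_uq_module smul A s q \<epsilon> ?E ?F ?K ?K' u"
    using affine_uq_module_of_module[OF assms(1-9)] .
  then interpret affine_uq_module smul A s q \<epsilon> ?E ?F ?K ?K' u .
  define \<psi> where "\<psi> = scaled_action \<epsilon> \<alpha> (\<lambda>g. \<rho> (Uq_gen A s q g))"
  have \<alpha>: "\<alpha> i \<noteq> 0" for i
    using assms(10) by blast
  have sq: "\<epsilon> i * \<epsilon> i = 1" for i
    using \<epsilon>_sign[of i] by auto
  have compat: "compatible smul A s q \<epsilon> \<alpha> \<rho> \<sigma> \<longleftrightarrow>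
      (\<forall>g. \<sigma> (rel_coset ?R (gen g)) = \<psi> g)" for \<sigma>
    unfolding compatible_iff[where \<epsilon> = \<epsilon> and \<alpha> = \<alpha>, OF \<epsilon>_sign \<alpha>] \<psi>_def Ugeq0_gen_def ..
  have "\<exists>!\<sigma>. module_structure smul (Ugeq0 A s q) \<sigma> \<and> compatible smul A s q \<epsilon> \<alpha> \<rho> \<sigma>"
  proof -
    obtain \<sigma> where "module_structure smul (presented_algebra ?R) \<sigma>"
      "\<And>g. \<sigma> (rel_coset ?R (gen g)) = \<psi> g"
      by (rule presented_module_exists[of \<psi> ?R])
        (use Ugeq0_relations_scaled_action[where \<epsilon> = \<epsilon> and \<alpha> = \<alpha>, OF assms(7) \<epsilon>_sign \<alpha>]
          in \<open>simp_all add: \<psi>_def\<close>)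
    moreover have "\<sigma>' = \<sigma>''"
      if "module_structure smul (presented_algebra ?R) \<sigma>'" "compatible smul A s q \<epsilon> \<alpha> \<rho> \<sigma>'"
        "module_structure smul (presented_algebra ?R) \<sigma>''" "compatible smul A s q \<epsilon> \<alpha> \<rho> \<sigma>''"
      for \<sigma>' \<sigma>''
      using presented_module_unique[OF that(1,3)] that(2,4) unfolding compat by metis
    ultimately show ?thesis
      unfolding Ugeq0_def using compat by metis
  qed
  moreover have "irreducible_module smul (Ugeq0 A s q) \<sigma> \<and> Ugeq0_type smul A s q \<sigma> \<alpha>"
    if \<sigma>: "module_structure smul (Ugeq0 A s q) \<sigma>" "compatible smul A s q \<epsilon> \<alpha> \<rho> \<sigma>" for \<sigma>
  proof
    have \<sigma>_gen: "\<sigma> (rel_coset ?R (gen g)) = \<psi> g" for g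
      using \<sigma>(2) compat by blast
    have "W = {0} \<or> W = UNIV" if W: "submodule_of smul (Ugeq0 A s q) \<sigma> W" for W
    proof -
      have W_sub: "subspace W" and W_\<psi>: "\<And>g w. w \<in> W \<Longrightarrow> \<psi> g w \<in> W"
        using W submodule_of_presented_iff[OF \<sigma>(1)[unfolded Ugeq0_def]]
        unfolding Ugeq0_def \<sigma>_gen by blast+
      \<comment> \<open>All scalars in the rescaled action are nonzero, so stability under it is
        stability under the original operators.\<close>
      have unscale: "x \<in> W" if "c \<cdot> x \<in> W" "c \<noteq> 0" for c x
      proof -
        have "inverse c \<cdot> (c \<cdot> x) \<in> W"
          using that(1) by (rule subspace_scale[OF W_sub])
        then show ?thesis
          using that(2) by simp
      qed
      show ?thesis
      proof (rule nonneg_part_irreducible[OF W_sub])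
        fix i w assume "w \<in> W"
        then have "\<psi> (Ue i) w \<in> W" "\<psi> (Uk i) w \<in> W" "\<psi> (Ukinv i) w \<in> W"
          by (simp_all only: W_\<psi>)
        then show "?E i w \<in> W" "?K i w \<in> W" "?K' i w \<in> W"
          using \<alpha>[of i] \<epsilon>_nonzero[of i] unfolding \<psi>_def scaled_action_simps
          by (auto dest!: unscale)
      qed
    qed
    moreover have "\<exists>v::'v. v \<noteq> 0"
      using assms(8) by (simp add: irreducible_module_def)
    ultimately show "irreducible_module smul (Ugeq0 A s q) \<sigma>"
      unfolding irreducible_module_def by blast
    have k: "\<sigma> (Ugeq0_gen A s q (Uk i)) = (\<lambda>v. (\<epsilon> i * \<alpha> i) \<cdot> ?K i v)" for i
      unfolding Ugeq0_gen_def \<sigma>_gen \<psi>_def scaled_action_simps ..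
    \<comment> \<open>The sign in the scaling cancels the sign in the eigenvalues of
      \<open>K\<close>, which is how type \<epsilon> becomes type \<alpha>.\<close>
    have k_eigen: "(\<epsilon> i * \<alpha> i) \<cdot> ?K i v = (\<alpha> i * x) \<cdot> v \<longleftrightarrow> ?K i v = (\<epsilon> i * x) \<cdot> v" for i v x
    proof
      assume "(\<epsilon> i * \<alpha> i) \<cdot> ?K i v = (\<alpha> i * x) \<cdot> v"
      then have "(\<epsilon> i * inverse (\<alpha> i)) \<cdot> ((\<epsilon> i * \<alpha> i) \<cdot> ?K i v)
          = (\<epsilon> i * inverse (\<alpha> i)) \<cdot> ((\<alpha> i * x) \<cdot> v)"
        by (rule arg_cong)
      moreover have "\<epsilon> i * inverse (\<alpha> i) * (\<epsilon> i * \<alpha> i) = 1"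
        using \<epsilon>_sign[of i] \<alpha>[of i] by auto
      moreover have "\<epsilon> i * inverse (\<alpha> i) * (\<alpha> i * x) = \<epsilon> i * x"
        using \<alpha>[of i] by simp
      ultimately show "?K i v = (\<epsilon> i * x) \<cdot> v"
        by (simp only: scale_scale scale_one)
    next
      assume "?K i v = (\<epsilon> i * x) \<cdot> v"
      moreover have "\<epsilon> i * \<alpha> i * (\<epsilon> i * x) = \<epsilon> i * \<epsilon> i * (\<alpha> i * x)"
        by (simp only: mult_ac)
      ultimately show "(\<epsilon> i * \<alpha> i) \<cdot> ?K i v = (\<alpha> i * x) \<cdot> v"
        by (simp only: scale_scale sq mult_1)
    qed
    show "Ugeq0_type smul A s q \<sigma> \<alpha>"
      unfolding Ugeq0_type_def
    proof (intro allI conjI)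
      fix i
      show "\<alpha> i \<noteq> 0" by (rule \<alpha>)
      have "{v. \<exists>\<theta>. ?K i v = \<theta> \<cdot> v} \<subseteq> {v. \<exists>\<theta>. (\<epsilon> i * \<alpha> i) \<cdot> ?K i v = \<theta> \<cdot> v}"
      proof clarify
        fix v \<theta> assume "?K i v = \<theta> \<cdot> v"
        then have "(\<epsilon> i * \<alpha> i) \<cdot> ?K i v = (\<epsilon> i * \<alpha> i * \<theta>) \<cdot> v"
          by simp
        then show "\<exists>\<theta>. (\<epsilon> i * \<alpha> i) \<cdot> ?K i v = \<theta> \<cdot> v" ..
      qed
      then show "acts_semisimply smul (\<sigma> (Ugeq0_gen A s q (Uk i)))"
        using span_mono K_semisimple[of i] unfolding acts_semisimply_def k by blast
      \<comment> \<open>These are the eigenvalues of \<open>K\<close> with the sign removed, so they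
        are pure powers of \<open>q ^ s i\<close>.\<close>
      define \<Delta> where
        "\<Delta> = {(q ^ s i) powi m | m. \<exists>v. v \<noteq> 0 \<and> ?K i v = (\<epsilon> i * (q ^ s i) powi m) \<cdot> v}"
      have eig: "eigenvalues smul (\<sigma> (Ugeq0_gen A s q (Uk i))) = (\<lambda>\<theta>. \<alpha> i * \<theta>) ` \<Delta>"
      proof
        show "eigenvalues smul (\<sigma> (Ugeq0_gen A s q (Uk i))) \<subseteq> (\<lambda>\<theta>. \<alpha> i * \<theta>) ` \<Delta>"
        proof
          fix \<theta> assume "\<theta> \<in> eigenvalues smul (\<sigma> (Ugeq0_gen A s q (Uk i)))"
          then obtain v where v: "v \<noteq> 0" "(\<epsilon> i * \<alpha> i) \<cdot> ?K i v = \<theta> \<cdot> v"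
            unfolding eigenvalues_def k by blast
          define x where "x = inverse (\<alpha> i) * \<theta>"
          have \<theta>: "\<theta> = \<alpha> i * x"
            using \<alpha>[of i] by (simp add: x_def)
          have K: "?K i v = (\<epsilon> i * x) \<cdot> v"
            using v(2) unfolding \<theta> k_eigen .
          obtain m where "\<epsilon> i * x = \<epsilon> i * (q ^ s i) powi m"
            using K_eigenvalue[OF v(1) K] by blast
          then have "x = (q ^ s i) powi m"
            using \<epsilon>_nonzero[of i] by simp
          then show "\<theta> \<in> (\<lambda>\<theta>. \<alpha> i * \<theta>) ` \<Delta>"
            using v(1) K unfolding \<theta> \<Delta>_def by blast
        qed
        show "(\<lambda>\<theta>. \<alpha> i * \<theta>) ` \<Delta> \<subseteq> eigenvalues smul (\<sigma> (Ugeq0_gen A s q (Uk i)))"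
          unfolding \<Delta>_def eigenvalues_def k using k_eigen by blast
      qed
      have sub: "\<Delta> \<subseteq> {(q ^ s i) powi m | m. True}"
        unfolding \<Delta>_def by blast
      \<comment> \<open>This is a fact about the original module: the weights of \<open>K\<close>
        are symmetric because both \<open>E\<close> and \<open>F\<close> act there.\<close>
      have inverse_\<Delta>: "inverse x \<in> \<Delta>" if x: "x \<in> \<Delta>" for x
      proof -
        from x obtain m v where x_eq: "x = (q ^ s i) powi m"
          and "v \<noteq> 0" "?K i v = (\<epsilon> i * (q ^ s i) powi m) \<cdot> v"
          unfolding \<Delta>_def by blast
        then have "(q ^ s i) powi (- m) \<in> \<Delta>"
          using eigenvalue_symmetric[of v i m] unfolding \<Delta>_def by blast
        then show ?thesis
          unfolding x_eq power_int_minus .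
      qed
      have inv: "\<Delta> = inverse ` \<Delta>"
      proof
        show "\<Delta> \<subseteq> inverse ` \<Delta>"
          using inverse_\<Delta> by (metis image_eqI inverse_inverse_eq subsetI)
        show "inverse ` \<Delta> \<subseteq> \<Delta>"
          using inverse_\<Delta> by blast
      qed
      show "\<exists>\<Delta>. eigenvalues smul (\<sigma> (Ugeq0_gen A s q (Uk i))) = (\<lambda>\<theta>. \<alpha> i * \<theta>) ` \<Delta> \<and>
          \<Delta> \<subseteq> {(q ^ s i) powi m | m. True} \<and> \<Delta> = inverse ` \<Delta>"
        by (intro exI[of _ \<Delta>] conjI eig sub inv)
    qed
  qed
  ultimately show ?thesis by blast
qed

end
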